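(* The quaternionic reflection groups associated with the binary tetrahedral, octahedral and icosahedral groups $\mathcal{T},\mathcal{O},\mathcal{I}$ (the fifteen groups listed in the context) have additional systems of imprimitivity, given by $(1,q)\in\mathbb{H}^2$, in exactly the following cases: (a) $(1,\frac{j-k}{\sqrt2})$, for $G_{\mathcal T}(L_{12}^{\mathcal T},C_2)$, $G_{\mathcal O}(L_{14}^{\mathcal O},1)$, $G_{\mathcal O}(L_{20}^{\mathcal O},C_2)$; (b) $(1,\frac{j-\tau i-\sigma k}{2})$, for $G_{\mathcal I}(L_{32}^{\mathcal I},C_2)$; and the infinite families (c) $(1,\alpha\frac{j-k}{\sqrt2})$, $-1<\alpha\le1$, $\alpha\ne0$, for $G_{\mathcal T}(L_{12}^{\mathcal T},1)$, $G_{\mathcal O}(L_{18}^{\mathcal O},1)$; (d) $(1,\alpha\frac{j-\tau i-\sigma k}{2})$, $-1<\alpha\le1$, $\alpha\ne0$, for $G_{\mathcal I}(L_{30}^{\mathcal I},1)$. For the groups above giving infinite families, there are the conjugacies in $\mathrm{GL}(\mathbb{H}^2)$ $$G_{\mathcal T}(L_{12}^{\mathcal T},1)\cong_{\mathbb H}G_{12},\qquad G_{\mathcal O}(L_{18}^{\mathcal O},1)\cong_{\mathbb H}G_{13},\qquad G_{\mathcal I}(L_{30}^{\mathcal I},1)\cong_{\mathbb H}G_{22},$$ where $G_{12},G_{13},G_{22}$ are the primitive complex reflection groups of rank two in the Shephard–Todd numbering.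
   Context: $\mathbb{H}$ denotes the quaternions with standard units $i,j,k$; $\mathbb{H}^2$ is a right vector space (matrices act on the left) with inner product $\langle v,w\rangle=\sum_j\overline{v_j}w_j$. A system of imprimitivity of a group $G\subset\mathrm{GL}(\mathbb{H}^2)$ is an unordered pair $\{V_1,V_2\}$ of one-dimensional subspaces with $\mathbb{H}^2=V_1\oplus V_2$ which is permuted by every element of $G$. The system given by $(1,q)$ is the pair consisting of the span of $(1,q)$ and its orthogonal complement, the span of $(-\overline{q},1)$. All $q$ are taken with $|q|\le1$, which gives every orthogonal system, each once, except that for $|q|=1$ the vectors $(1,q)$ and $(1,-q)$ give the same system (only one of them is listed). "Additional" means other than the system given by the standard basis. $\cong_{\mathbb H}$ denotes conjugacy in $\mathrm{GL}(\mathbb{H}^2)$. Let $\tau=\frac{1+\sqrt5}{2}$, $\sigma=1-\tau$, $w=\frac{1+i+j+k}{2}$, and $v=\frac{\tau+\sigma i-j}{2}$. For sets $\mathcal{L},\mathcal{H}$ of unit quaternions, $$\mathcal{G}(\mathcal{L},\mathcal{H}):=\Bigl\langle \bigl\{\begin{pmatrix}0&\beta\\ \overline{\beta}&0\end{pmatrix}\bigr\}_{\beta\in\mathcal{L}}\cup\bigl\{\begin{pmatrix}h&0\\0&1\end{pmatrix}\bigr\}_{h\in\mathcal{H}}\Bigr\rangle .$$ The groups are (the arguments of $G_K(L,H)$ being labels for the reflection system $L$ and the group $H$; $C_2=\{\pm1\}$, $Q_8$ the quaternion group): For $\mathcal{T}$: $G_{\mathcal T}(\mathcal T,\mathcal T)=\mathcal{G}(\{1,i\},\{w\})$;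 $G_{\mathcal T}(\mathcal T,Q_8)=\mathcal{G}(\{1,i,j,w\},\{\})$; $G_{\mathcal T}(L_{12}^{\mathcal T},C_2)=\mathcal{G}(\{1,i,w\},\{-1\})$; $G_{\mathcal T}(L_{12}^{\mathcal T},1)=\mathcal{G}(\{1,i,w\},\{\})$. For $\mathcal{O}$: $G_{\mathcal O}(\mathcal O,\mathcal O)=\mathcal{G}(\{1,w\},\{\frac{1+i}{\sqrt2}\})$; $G_{\mathcal O}(\mathcal O,\mathcal T)=\mathcal{G}(\{1,\frac{1+i}{\sqrt2},\frac{1+j}{\sqrt2},w\},\{\})$; $G_{\mathcal O}(L_{32}^{\mathcal O},Q_8)=\mathcal{G}(\{1,\frac{1+i}{\sqrt2},j,w\},\{\})$; $G_{\mathcal O}(L_{20}^{\mathcal O},C_2)=\mathcal{G}(\{1,\frac{1+i}{\sqrt2},w,\frac{j-k}{\sqrt2}\},\{\})$; $G_{\mathcal O}(L_{18}^{\mathcal O},1)=\mathcal{G}(\{1,\frac{1+i}{\sqrt2},w\},\{\})$; $G_{\mathcal O}(L_{14}^{\mathcal O},1)=\mathcal{G}(\{1,i,w,\frac{j-k}{\sqrt2}\},\{\})$. For $\mathcal{I}$: $G_{\mathcal I}(\mathcal I,\mathcal I)=\mathcal{G}(\{1,i,w,v\},\{\})$; $G_{\mathcal I}(L_{32}^{\mathcal I},C_2)=\mathcal{G}(\{1,w,v,\frac{j-\tau i-\sigma k}{2}\},\{\})$; $G_{\mathcal I}(L_{30}^{\mathcal I},1)=\mathcal{G}(\{1,w,v\},\{\})$;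 $G_{\mathcal I}(L_{20}^{\mathcal I},C_2)=\mathcal{G}(\{1,i,w,\frac{i+\sigma j+\tau k}{2}\},\{-1\})$; $G_{\mathcal I}(L_{20}^{\mathcal I},1)=\mathcal{G}(\{1,i,w,\frac{i+\sigma j+\tau k}{2}\},\{\})$. *)

theory Defs
  imports "HOL-Analysis.Analysis" "HOL-Algebra.Generated_Groups"
begin

section \<open>Quaternions\<close>

codatatype quat = Quat (Re0: real) (Im1: real) (Im2: real) (Im3: real)

lemma quat_eqI [intro?]:
  "\<lbrakk>Re0 x = Re0 y; Im1 x = Im1 y; Im2 x = Im2 y; Im3 x = Im3 y\<rbrakk> \<Longrightarrow> x = y"
  by (rule quat.expand) simp

lemma quat_eq_iff:
  "x = y \<longleftrightarrow> Re0 x = Re0 y \<and> Im1 x = Im1 y \<and> Im2 x = Im2 y \<and> Im3 x = Im3 y"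
  by (auto intro: quat.expand)

instantiation quat :: ab_group_add
begin

primcorec zero_quat where
  "Re0 0 = 0" | "Im1 0 = 0" | "Im2 0 = 0" | "Im3 0 = 0"

primcorec plus_quat where
  "Re0 (x + y) = Re0 x + Re0 y" | "Im1 (x + y) = Im1 x + Im1 y"
| "Im2 (x + y) = Im2 x + Im2 y" | "Im3 (x + y) = Im3 x + Im3 y"

primcorec uminus_quat where
  "Re0 (- x) = - Re0 x" | "Im1 (- x) = - Im1 x" | "Im2 (- x) = - Im2 x" | "Im3 (- x) = - Im3 x"

primcorec minus_quat where
  "Re0 (x - y) = Re0 x - Re0 y" | "Im1 (x - y) = Im1 x - Im1 y"
| "Im2 (x - y) = Im2 x - Im2 y" | "Im3 (x - y) = Im3 x - Im3 y"

instance
  by standard (simp_all add: quat_eq_iff)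

end

primcorec qcnj :: "quat \<Rightarrow> quat" where
  "Re0 (qcnj x) = Re0 x" | "Im1 (qcnj x) = - Im1 x"
| "Im2 (qcnj x) = - Im2 x" | "Im3 (qcnj x) = - Im3 x"

instantiation quat :: real_vector
begin

primcorec scaleR_quat where
  "Re0 (scaleR r x) = r * Re0 x" | "Im1 (scaleR r x) = r * Im1 x"
| "Im2 (scaleR r x) = r * Im2 x" | "Im3 (scaleR r x) = r * Im3 x"

instance
  by standard (simp_all add: quat_eq_iff algebra_simps)

end

instantiation quat :: real_algebra_1
begin

primcorec one_quat where
  "Re0 1 = 1" | "Im1 1 = 0" | "Im2 1 = 0" | "Im3 1 = 0"

primcorec times_quat where
  "Re0 (x * y) = Re0 x * Re0 y - Im1 x * Im1 y - Im2 x * Im2 y - Im3 x * Im3 y"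
| "Im1 (x * y) = Re0 x * Im1 y + Im1 x * Re0 y + Im2 x * Im3 y - Im3 x * Im2 y"
| "Im2 (x * y) = Re0 x * Im2 y - Im1 x * Im3 y + Im2 x * Re0 y + Im3 x * Im1 y"
| "Im3 (x * y) = Re0 x * Im3 y + Im1 x * Im2 y - Im2 x * Im1 y + Im3 x * Re0 y"

instance
  by standard (simp_all add: quat_eq_iff algebra_simps)

end

instantiation quat :: real_div_algebra
begin

definition inverse_quat :: "quat \<Rightarrow> quat" where
  "inverse x = qcnj x /\<^sub>R ((Re0 x)\<^sup>2 + (Im1 x)\<^sup>2 + (Im2 x)\<^sup>2 + (Im3 x)\<^sup>2)"

definition divide_quat :: "quat \<Rightarrow> quat \<Rightarrow> quat" where
  "x div y = x * inverse (y::quat)"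

instance
proof
  fix x :: quat
  let ?n = "(Re0 x)\<^sup>2 + (Im1 x)\<^sup>2 + (Im2 x)\<^sup>2 + (Im3 x)\<^sup>2"
  assume "x \<noteq> 0"
  then have n: "?n \<noteq> 0"
    by (simp add: quat_eq_iff add_nonneg_eq_0_iff)
  have "qcnj x * x = ?n *\<^sub>R 1" "x * qcnj x = ?n *\<^sub>R 1"
    by (simp_all add: quat_eq_iff power2_eq_square algebra_simps)
  with n show "inverse x * x = 1" "x * inverse x = 1"
    by (simp_all add: inverse_quat_def)
qed (simp_all add: divide_quat_def, simp add: inverse_quat_def quat_eq_iff)

end

definition qi :: quat where "qi = Quat 0 1 0 0"
definition qj :: quat where "qj = Quat 0 0 1 0"
definition qk :: quat where "qk = Quat 0 0 0 1"


section \<open>The right vector space of column vectors\<close>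

definition rscale :: "quat^2 \<Rightarrow> quat \<Rightarrow> quat^2" (infixl \<open>*\<^sub>h\<close> 75) where
  "v *\<^sub>h a = (\<chi> n. v $ n * a)"

definition hspan :: "quat^2 \<Rightarrow> (quat^2) set" where
  "hspan v = range (\<lambda>a. v *\<^sub>h a)"

definition one_dim_subspace :: "(quat^2) set \<Rightarrow> bool" where
  "one_dim_subspace V \<longleftrightarrow> (\<exists>v. v \<noteq> 0 \<and> V = hspan v)"

definition hinner :: "quat^2 \<Rightarrow> quat^2 \<Rightarrow> quat" where
  "hinner v w = (\<Sum>n\<in>UNIV. qcnj (v $ n) * w $ n)"

definition orth_compl :: "(quat^2) set \<Rightarrow> (quat^2) set" where
  "orth_compl V = {w. \<forall>v\<in>V. hinner v w = 0}"


section \<open>Systems of imprimitivity\<close>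

text \<open>The unordered pair is the set \<open>S = {V\<^sub>1, V\<^sub>2}\<close>; its two members are
  automatically distinct. Neither orthogonality nor any relation to \<open>hinner\<close> is required.\<close>

definition imprimitivity_system :: "(quat^2^2) set \<Rightarrow> (quat^2) set set \<Rightarrow> bool" where
  "imprimitivity_system G S \<longleftrightarrow>
     (\<exists>V1 V2. S = {V1, V2} \<and> one_dim_subspace V1 \<and> one_dim_subspace V2 \<and>
        V1 \<inter> V2 = {0} \<and> {x + y |x y. x \<in> V1 \<and> y \<in> V2} = UNIV) \<and>
     (\<forall>g\<in>G. (\<lambda>V. (*v) g ` V) ` S = S)"

definition system_of :: "quat \<Rightarrow> (quat^2) set set" where
  "system_of q = {hspan (vector [1, q]), orth_compl (hspan (vector [1, q]))}"

definition standard_system :: "(quat^2) set set" where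
  "standard_system = {hspan (vector [1, 0]), hspan (vector [0, 1])}"

definition additional_systems :: "(quat^2^2) set \<Rightarrow> (quat^2) set set set" where
  "additional_systems G = {S. imprimitivity_system G S \<and> S \<noteq> standard_system}"

lemma orth_compl_hspan: "orth_compl (hspan (vector [1, q])) = hspan (vector [- qcnj q, 1])"
proof -
  have c: "qcnj (x * y) = qcnj y * qcnj x" for x y :: quat
    by (simp add: quat_eq_iff algebra_simps)
  have "w \<in> orth_compl (hspan (vector [1, q])) \<longleftrightarrow> w $ 1 = - qcnj q * w $ 2" for w
  proof -
    have "w \<in> orth_compl (hspan (vector [1, q]))
        \<longleftrightarrow> (\<forall>a. qcnj a * (w $ 1 + qcnj q * w $ 2) = 0)"
      by (simp add: orth_compl_def hspan_def hinner_def rscale_def sum_2 c algebra_simps)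
    also have "\<dots> \<longleftrightarrow> w $ 1 + qcnj q * w $ 2 = 0"
    proof
      assume "\<forall>a. qcnj a * (w $ 1 + qcnj q * w $ 2) = 0"
      then have "qcnj 1 * (w $ 1 + qcnj q * w $ 2) = 0" by blast
      moreover have "qcnj 1 = 1" by (simp add: quat_eq_iff)
      ultimately show "w $ 1 + qcnj q * w $ 2 = 0" by simp
    qed simp
    finally show ?thesis by (simp add: add_eq_0_iff2)
  qed
  moreover have "w \<in> hspan (vector [- qcnj q, 1]) \<longleftrightarrow> w $ 1 = - qcnj q * w $ 2" for w
    by (auto simp: hspan_def rscale_def vec_eq_iff forall_2 image_iff)
  ultimately show ?thesis by blast
qed


section \<open>Linear groups\<close>

definition GL :: "('a::semiring_1^'n^'n) monoid" where
  "GL = \<lparr>carrier = {A. invertible A}, mult = (**), one = mat 1\<rparr>"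

lemma group_GL: "group (GL :: ('a::semiring_1^'n^'n) monoid)"
proof (rule groupI)
  fix A :: "'a^'n^'n"
  assume "A \<in> carrier GL"
  then obtain B where "A ** B = mat 1" "B ** A = mat 1"
    by (auto simp: GL_def invertible_def)
  then show "\<exists>y\<in>carrier GL. y \<otimes>\<^bsub>GL\<^esub> A = \<one>\<^bsub>GL\<^esub>"
    by (auto simp: GL_def invertible_def)
next
  fix A B :: "'a^'n^'n"
  assume "A \<in> carrier GL" "B \<in> carrier GL"
  then show "A \<otimes>\<^bsub>GL\<^esub> B \<in> carrier GL"
    by (simp add: GL_def invertible_mult)
qed (auto simp: GL_def matrix_mul_assoc invertible_def intro: exI[of _ "mat 1"])

definition GL_conjugate :: "('a::semiring_1^'n^'n) set \<Rightarrow> ('a^'n^'n) set \<Rightarrow> bool" where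
  "GL_conjugate G K \<longleftrightarrow> (\<exists>P. invertible P \<and> K = (\<lambda>A. P ** A ** matrix_inv P) ` G)"

definition mat2 :: "'a::zero \<Rightarrow> 'a \<Rightarrow> 'a \<Rightarrow> 'a \<Rightarrow> 'a^2^2" where
  "mat2 a b c d = vector [vector [a, b], vector [c, d]]"

text \<open>The group \<open>\<G>(L, H)\<close>; it is only used for sets of unit quaternions, for which the
  generators are invertible.\<close>

definition QG :: "quat set \<Rightarrow> quat set \<Rightarrow> (quat^2^2) set" where
  "QG L H = generate GL ((\<lambda>b. mat2 0 b (qcnj b) 0) ` L \<union> (\<lambda>h. mat2 h 0 0 1) ` H)"

definition tau :: real where "tau = (1 + sqrt 5) / 2"
definition sigma :: real where "sigma = 1 - tau"

definition qw :: quat where "qw = (1 + qi + qj + qk) /\<^sub>R 2"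
definition qv :: quat where "qv = (tau *\<^sub>R 1 + sigma *\<^sub>R qi - qj) /\<^sub>R 2"

definition qu :: quat where "qu = (qj - qk) /\<^sub>R sqrt 2"
definition qz :: quat where "qz = (qj - tau *\<^sub>R qi - sigma *\<^sub>R qk) /\<^sub>R 2"

definition "GT_T_T = QG {1, qi} {qw}"
definition "GT_T_Q8 = QG {1, qi, qj, qw} {}"
definition "GT_L12_C2 = QG {1, qi, qw} {- 1}"
definition "GT_L12_1 = QG {1, qi, qw} {}"

definition "GO_O_O = QG {1, qw} {(1 + qi) /\<^sub>R sqrt 2}"
definition "GO_O_T = QG {1, (1 + qi) /\<^sub>R sqrt 2, (1 + qj) /\<^sub>R sqrt 2, qw} {}"
definition "GO_L32_Q8 = QG {1, (1 + qi) /\<^sub>R sqrt 2, qj, qw} {}"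
definition "GO_L20_C2 = QG {1, (1 + qi) /\<^sub>R sqrt 2, qw, qu} {}"
definition "GO_L18_1 = QG {1, (1 + qi) /\<^sub>R sqrt 2, qw} {}"
definition "GO_L14_1 = QG {1, qi, qw, qu} {}"

definition "GI_I_I = QG {1, qi, qw, qv} {}"
definition "GI_L32_C2 = QG {1, qw, qv, qz} {}"
definition "GI_L30_1 = QG {1, qw, qv} {}"
definition "GI_L20_C2 = QG {1, qi, qw, (qi + sigma *\<^sub>R qj + tau *\<^sub>R qk) /\<^sub>R 2} {- 1}"
definition "GI_L20_1 = QG {1, qi, qw, (qi + sigma *\<^sub>R qj + tau *\<^sub>R qk) /\<^sub>R 2} {}"


section \<open>Three Shephard-Todd groups\<close>

text \<open>Unitary representatives of the conjugacy classes of primitive rank two reflection groups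
  number 12, 13 and 22 in the Shephard-Todd list, generated by reflections of order two in the
  style of Lehrer and Taylor. They have orders 48, 96 and 240; each of the three classes is the
  only one of that order among the primitive rank two groups generated by reflections of order
  two.\<close>

definition G12 :: "(complex^2^2) set" where
  "G12 = generate GL
    {mat2 (1 / sqrt 2) (- 1 / sqrt 2) (- 1 / sqrt 2) (- 1 / sqrt 2),
     mat2 (1 / sqrt 2) (1 / sqrt 2) (1 / sqrt 2) (- 1 / sqrt 2),
     mat2 0 ((1 + \<i>) / sqrt 2) ((1 - \<i>) / sqrt 2) 0}"

definition G13 :: "(complex^2^2) set" where
  "G13 = generate GL
    {mat2 1 0 0 (- 1),
     mat2 (1 / sqrt 2) (- 1 / sqrt 2) (- 1 / sqrt 2) (- 1 / sqrt 2),
     mat2 0 ((1 + \<i>) / sqrt 2) ((1 - \<i>) / sqrt 2) 0}"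

definition G22 :: "(complex^2^2) set" where
  "G22 = generate GL
    {mat2 1 0 0 (- 1),
     mat2 0 1 1 0,
     mat2 (tau / 2) ((1 + (tau - 1) * \<i>) / 2) ((1 - (tau - 1) * \<i>) / 2) (- tau / 2)}"

text \<open>The inclusion of complex into quaternionic matrices sending \<open>\<i>\<close> to the quaternion \<open>i\<close>.\<close>

definition quat_of_complex :: "complex \<Rightarrow> quat" where
  "quat_of_complex z = Quat (Re z) (Im z) 0 0"

definition quat_matrix :: "complex^2^2 \<Rightarrow> quat^2^2" where
  "quat_matrix A = (\<chi> m n. quat_of_complex (A $ m $ n))"

end

theory Submission
  imports Defs
begin

text \<open>The one-dimensional subspaces of \<open>\<H>\<^sup>2\<close> form the projective line over the quaternions: the
subspace \<open>line q\<close> spanned by \<open>(1, q)\<close> corresponds to the quaternion \<open>q\<close>, and \<open>line_inf\<close> is the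
point at infinity. On this projective line the reflection with parameter \<open>b\<close> acts as
\<open>q \<mapsto> b' q\<^sup>-\<^sup>1 b'\<close>, where \<open>b'\<close> is the conjugate of \<open>b\<close>, and the homology \<open>diag(h, 1)\<close> acts as
\<open>q \<mapsto> q h'\<close>. As \<open>1 \<in> L\<close> exchanges \<open>0\<close> and infinity, an additional system is a pair of distinct
nonzero quaternions that is preserved by these maps (\<open>additional_systems_iff\<close>).

A reflection with parameter \<open>b\<close> either exchanges the two quaternions of the pair or fixes
both, and its fixed points are \<open>b'\<close> and \<open>- b'\<close>. If \<open>L\<close> contains some \<open>c\<close> that is neither real nor
pure, such as \<open>w\<close>, then the pair must be \<open>{q, q\<^sup>-\<^sup>1}\<close> with \<open>c q = q c'\<close>, which makes \<open>q\<close> pure. For a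
pure \<open>q\<close> this pair is the orthogonal system given by \<open>(1, q)\<close>, and it is preserved by the
reflection with parameter \<open>b\<close> exactly if \<open>b\<close> is orthogonal to \<open>q\<close> or equal to \<open>\<plusminus> q\<close>. Thus
(\<open>additional_systems_pure\<close>) the problem is to find the vectors \<open>q\<close> of \<open>\<real>\<^sup>3\<close> that satisfy these
conditions. Orthogonality to \<open>w\<close> and to one further member of \<open>L\<close>, namely \<open>i\<close> or \<open>(1 + i) / \<surd>2\<close>,
respectively \<open>v\<close>, leaves the real multiples of a unit vector \<open>u\<close>, respectively \<open>z\<close>. For the three
groups without more generators this gives a family, in which \<open>\<alpha>\<close> and \<open>- 1 / \<alpha>\<close> belong to the same
system. The homology \<open>- 1\<close>, and likewise the reflection whose parameter is the axis \<open>u\<close> or \<open>z\<close>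
itself, forces \<open>\<alpha> = \<plusminus> 1\<close>; a further parameter that is neither the axis nor orthogonal to it leaves
nothing. A homology
\<open>h\<close> with \<open>h\<^sup>2 \<noteq> 1\<close> preserves no pair of nonzero quaternions at all.

For the conjugacies: if every member of \<open>L\<close> is orthogonal to the pure unit \<open>u\<close>, then the matrix \<open>J\<close>
with rows \<open>(0, u)\<close> and \<open>(u, 0)\<close> commutes with all reflections, and \<open>J\<^sup>2 = - 1\<close>. In a basis of \<open>\<H>\<^sup>2\<close>
of vectors \<open>x\<close> with \<open>J x = x i\<close> (or \<open>J x = - x i\<close>) matrices commuting with \<open>J\<close> have complex entries.
A complex unitary reflection of order two with eigenvalues \<open>1\<close> and \<open>- 1\<close> is a unit vector of \<open>\<real>\<^sup>3\<close> in
terms of the Pauli matrices, half the trace of a product being the inner product; this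
identifies the parameters in the orthogonal complement of \<open>u\<close> isometrically with unit vectors of
\<open>\<real>\<^sup>3\<close>. Comparing inner products of the generators tells which reflections of \<open>G\<^sub>1\<^sub>2\<close>, \<open>G\<^sub>1\<^sub>3\<close>, \<open>G\<^sub>2\<^sub>2\<close>
the given generators should become; the sign of \<open>J\<close> accounts for the orientation.\<close>


section \<open>Unit and pure quaternions\<close>

definition qdot :: "quat \<Rightarrow> quat \<Rightarrow> real" where
  "qdot x y = Re0 x * Re0 y + Im1 x * Im1 y + Im2 x * Im2 y + Im3 x * Im3 y"

lemma quat_unit_selectors [simp]:
  "Re0 qi = 0" "Im1 qi = 1" "Im2 qi = 0" "Im3 qi = 0"
  "Re0 qj = 0" "Im1 qj = 0" "Im2 qj = 1" "Im3 qj = 0"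
  "Re0 qk = 0" "Im1 qk = 0" "Im2 qk = 0" "Im3 qk = 1"
  by (simp_all add: qi_def qj_def qk_def)

lemma qcnj_simps [simp]:
  "qcnj 0 = 0" "qcnj 1 = 1" "qcnj (- x) = - qcnj x" "qcnj (qcnj x) = x"
  "qcnj (x * y) = qcnj y * qcnj x"
  by (simp_all add: quat_eq_iff algebra_simps)

lemma unit_quat_cnj:
  assumes "qdot b b = 1"
  shows "qcnj b * b = 1" "b * qcnj b = 1"
  using assms by (simp_all add: quat_eq_iff qdot_def algebra_simps)

lemma unit_quat_cancel:
  assumes "qdot b b = 1"
  shows "qcnj b * (b * x) = x" "b * (qcnj b * x) = x"
  using unit_quat_cnj[OF assms] by (simp_all flip: mult.assoc)

lemma unit_quat_nonzero: "qdot b b = 1 \<Longrightarrow> b \<noteq> 0 \<and> qcnj b \<noteq> 0"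
  using unit_quat_cnj[of b] by fastforce

lemma pure_unit_square: "Re0 q = 0 \<Longrightarrow> q * q = - 1 \<longleftrightarrow> qdot q q = 1"
  by (auto simp: quat_eq_iff qdot_def)

lemma qcnj_eq_iff: "qcnj x = y \<longleftrightarrow> x = qcnj y"
  by auto

text \<open>For a pure \<open>q\<close>, the difference of the two sides is \<open>b q + q b = - 2 (b \<cdot> q)\<close> with \<open>b\<close> replaced by
its vector part.\<close>

lemma pure_swap_iff:
  assumes "Re0 q = 0"
  shows "b * q = q * qcnj b \<longleftrightarrow> qdot b q = 0"
  using assms by (auto simp: quat_eq_iff qdot_def algebra_simps)

text \<open>The vector parts of \<open>b q\<close> and \<open>q b'\<close> differ by twice \<open>Re0 q\<close> times the vector part of \<open>b\<close>.\<close>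

lemma twisted_commuting_pure:
  assumes comm: "b * q = q * qcnj b" and b: "b \<noteq> qcnj b"
  shows "Re0 q = 0"
proof -
  have "Re0 q * Im1 b = 0" "Re0 q * Im2 b = 0" "Re0 q * Im3 b = 0"
    using comm by (simp_all add: quat_eq_iff algebra_simps)
  then show ?thesis using b by (auto simp: quat_eq_iff)
qed


section \<open>The quaternionic projective line\<close>

definition line :: "quat \<Rightarrow> (quat^2) set" where
  "line q = hspan (vector [1, q])"

definition line_inf :: "(quat^2) set" where
  "line_inf = hspan (vector [0, 1])"

lemma mem_line: "x \<in> line q \<longleftrightarrow> x $ 2 = q * x $ 1"
  by (auto simp: line_def hspan_def rscale_def vec_eq_iff forall_2 image_iff)

lemma mem_line_inf: "x \<in> line_inf \<longleftrightarrow> x $ 1 = 0"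
  by (auto simp: line_inf_def hspan_def rscale_def vec_eq_iff forall_2 image_iff)

lemma line_inject [simp]: "line p = line q \<longleftrightarrow> p = q"
proof
  assume "line p = line q"
  moreover have "vector [1, p] \<in> line p" by (simp add: mem_line)
  ultimately have "vector [1, p] \<in> line q" by simp
  then show "p = q" by (simp add: mem_line)
qed simp

lemma line_neq_inf [simp]: "line q \<noteq> line_inf" "line_inf \<noteq> line q"
proof -
  have "vector [1, q] \<in> line q" "vector [1, q] \<notin> line_inf"
    by (simp_all add: mem_line mem_line_inf)
  then show "line q \<noteq> line_inf" "line_inf \<noteq> line q" by blast+
qed

lemma one_dim_subspace_iff: "one_dim_subspace V \<longleftrightarrow> V = line_inf \<or> (\<exists>q. V = line q)"
proof
  assume "one_dim_subspace V"
  then obtain v where v: "v \<noteq> 0" "V = hspan v" by (auto simp: one_dim_subspace_def)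
  show "V = line_inf \<or> (\<exists>q. V = line q)"
  proof (cases "v $ 1 = 0")
    case True
    with v have nz: "v $ 2 \<noteq> 0" by (auto simp: vec_eq_iff forall_2)
    have "x \<in> hspan v \<longleftrightarrow> x \<in> line_inf" for x
    proof
      assume "x \<in> line_inf"
      then have "x = v *\<^sub>h (inverse (v $ 2) * x $ 2)"
        using True nz by (simp add: mem_line_inf rscale_def vec_eq_iff forall_2 flip: mult.assoc)
      then show "x \<in> hspan v" by (auto simp: hspan_def)
    qed (use True in \<open>auto simp: mem_line_inf hspan_def rscale_def\<close>)
    with v show ?thesis by blast
  next
    case False
    have "x \<in> hspan v \<longleftrightarrow> x \<in> line (v $ 2 * inverse (v $ 1))" for x
    proof
      assume "x \<in> line (v $ 2 * inverse (v $ 1))"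
      then have "x = v *\<^sub>h (inverse (v $ 1) * x $ 1)"
        using False by (simp add: mem_line rscale_def vec_eq_iff forall_2 flip: mult.assoc)
      then show "x \<in> hspan v" by (auto simp: hspan_def)
    next
      assume "x \<in> hspan v"
      then obtain a where "x = v *\<^sub>h a" by (auto simp: hspan_def)
      then show "x \<in> line (v $ 2 * inverse (v $ 1))"
        using False by (simp add: mem_line rscale_def mult.assoc)
          (simp flip: mult.assoc[of "inverse (v $ 1)"])
    qed
    with v show ?thesis by blast
  qed
next
  have "vector [1, q] \<noteq> (0 :: quat^2)" "vector [0, 1] \<noteq> (0 :: quat^2)" for q :: quat
    by (simp_all add: vec_eq_iff forall_2)
  then show "V = line_inf \<or> (\<exists>q. V = line q) \<Longrightarrow> one_dim_subspace V"
    unfolding one_dim_subspace_def line_def line_inf_def by blast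
qed

lemma lines_complementary:
  assumes "p \<noteq> q"
  shows "line p \<inter> line q = {0}" "{x + y |x y. x \<in> line p \<and> y \<in> line q} = UNIV"
proof -
  have "x = 0" if "x \<in> line p" "x \<in> line q" for x
  proof -
    have "(p - q) * x $ 1 = 0" using that by (simp add: mem_line algebra_simps)
    then show ?thesis using assms that by (simp add: mem_line vec_eq_iff forall_2)
  qed
  then show "line p \<inter> line q = {0}" by (auto simp: mem_line)
  have "\<exists>x y. z = x + y \<and> x \<in> line p \<and> y \<in> line q" for z :: "quat^2"
  proof -
    define a where "a = inverse (p - q) * (z $ 2 - q * z $ 1)"
    have "(p - q) * a = z $ 2 - q * z $ 1"
      using assms by (simp add: a_def flip: mult.assoc)
    then have "z = vector [a, p * a] + vector [z $ 1 - a, q * (z $ 1 - a)]"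
      by (simp add: vec_eq_iff forall_2 algebra_simps)
    then show ?thesis by (intro exI conjI) (auto simp: mem_line)
  qed
  then show "{x + y |x y. x \<in> line p \<and> y \<in> line q} = UNIV" by blast
qed

lemma line_not_trivial: "line q \<noteq> {0}" "line_inf \<noteq> {0}"
proof -
  have "vector [1, q] \<in> line q" "vector [0, 1] \<in> line_inf"
    by (simp_all add: mem_line mem_line_inf)
  moreover have "vector [1, q] \<noteq> (0 :: quat^2)" "vector [0, 1] \<noteq> (0 :: quat^2)"
    by (simp_all add: vec_eq_iff forall_2)
  ultimately show "line q \<noteq> {0}" "line_inf \<noteq> {0}"
    by blast+
qed

lemma standard_system_eq: "standard_system = {line 0, line_inf}"
  by (simp add: standard_system_def line_def line_inf_def)

text \<open>The orthogonal complement of \<open>(1, q)\<close> is spanned by \<open>(- q', 1)\<close>; rescaled to first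
coordinate \<open>1\<close>, this is \<open>(1, - q'\<^sup>-\<^sup>1)\<close>.\<close>

lemma system_of_eq:
  assumes "q \<noteq> 0"
  shows "system_of q = {line q, line (- inverse (qcnj q))}"
proof -
  have nz: "qcnj q \<noteq> 0" using assms by (metis qcnj_simps(1,4))
  have "x $ 1 = - qcnj q * x $ 2 \<longleftrightarrow> x $ 2 = - inverse (qcnj q) * x $ 1" for x :: "quat^2"
  proof
    assume "x $ 1 = - qcnj q * x $ 2"
    then have "- inverse (qcnj q) * x $ 1 = inverse (qcnj q) * qcnj q * x $ 2"
      by (simp add: mult.assoc)
    then show "x $ 2 = - inverse (qcnj q) * x $ 1" using nz by simp
  next
    assume "x $ 2 = - inverse (qcnj q) * x $ 1"
    then have "- qcnj q * x $ 2 = qcnj q * inverse (qcnj q) * x $ 1"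
      by (simp add: mult.assoc)
    then show "x $ 1 = - qcnj q * x $ 2" using nz by simp
  qed
  moreover have "x \<in> hspan (vector [- qcnj q, 1]) \<longleftrightarrow> x $ 1 = - qcnj q * x $ 2" for x
    by (auto simp: hspan_def rscale_def vec_eq_iff forall_2 image_iff)
  ultimately have "hspan (vector [- qcnj q, 1]) = line (- inverse (qcnj q))"
    by (auto simp: mem_line)
  then show ?thesis by (simp add: system_of_def orth_compl_hspan line_def)
qed


section \<open>Matrix groups and their action on lines\<close>

lemma mult_GL [simp]: "mult GL = (**)" and one_GL [simp]: "one GL = mat 1"
  by (simp_all add: GL_def)

lemma carrier_GL: "A \<in> carrier GL \<longleftrightarrow> invertible A"
  by (simp add: GL_def)

lemma mat2_mult [simp]:
  "mat2 a b c d ** mat2 a' b' c' d' =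
    mat2 (a * a' + b * c') (a * b' + b * d') (c * a' + d * c') (c * b' + d * d' :: 'a::semiring_1)"
  by (simp add: mat2_def matrix_matrix_mult_def vec_eq_iff forall_2 sum_2)

lemma mat2_inject [simp]:
  "mat2 a b c d = mat2 a' b' c' d' \<longleftrightarrow> a = a' \<and> b = b' \<and> c = c' \<and> d = d'"
  by (auto simp: mat2_def vec_eq_iff forall_2)

lemma mat_1_mat2: "(mat 1 :: 'a::semiring_1^2^2) = mat2 1 0 0 1"
  by (simp add: mat2_def mat_def vec_eq_iff forall_2)

lemma mat2_vector: "mat2 a b c d *v x = vector [a * x $ 1 + b * x $ 2, c * x $ 1 + d * x $ (2::2)]"
  by (simp add: mat2_def matrix_vector_mult_def vec_eq_iff forall_2 sum_2)

definition swap_mat :: "quat \<Rightarrow> quat^2^2" where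
  "swap_mat b = mat2 0 b (qcnj b) 0"

definition dil_mat :: "quat \<Rightarrow> quat^2^2" where
  "dil_mat h = mat2 h 0 0 1"

lemma QG_eq: "QG L H = generate GL (swap_mat ` L \<union> dil_mat ` H)"
  by (simp add: QG_def swap_mat_def dil_mat_def)

lemma swap_involution: "qdot b b = 1 \<Longrightarrow> swap_mat b ** swap_mat b = mat 1"
  by (simp add: swap_mat_def mat_1_mat2 unit_quat_cnj)

lemma dil_inverse:
  assumes "qdot h h = 1"
  shows "dil_mat h ** dil_mat (qcnj h) = mat 1" "dil_mat (qcnj h) ** dil_mat h = mat 1"
  using assms by (simp_all add: dil_mat_def mat_1_mat2 unit_quat_cnj)

lemma QG_generators_carrier:
  assumes "\<forall>b\<in>L. qdot b b = 1" "\<forall>h\<in>H. qdot h h = 1"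
  shows "swap_mat ` L \<union> dil_mat ` H \<subseteq> carrier GL"
  using assms swap_involution dil_inverse by (auto simp: carrier_GL invertible_def) blast+

lemma image_mult_vec:
  fixes A B :: "'a::semiring_1^'n^'n"
  assumes "B ** A = mat 1" "A ** B = mat 1"
  shows "(*v) A ` V = {x. B *v x \<in> V}"
proof -
  have "B *v (A *v x) = x" "A *v (B *v x) = x" for x
    using assms by (simp_all add: matrix_vector_mul_assoc)
  then show ?thesis by (auto simp: image_iff) metis
qed

lemma swap_line:
  assumes b: "qdot b b = 1" and "q \<noteq> 0"
  shows "(*v) (swap_mat b) ` line q = line (qcnj b * inverse q * qcnj b)"
proof -
  have "qcnj b * x = q * (b * y) \<longleftrightarrow> y = qcnj b * inverse q * qcnj b * x" for x y
  proof
    assume "qcnj b * x = q * (b * y)"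
    then have "qcnj b * inverse q * qcnj b * x = qcnj b * (inverse q * q) * b * y"
      by (simp add: mult.assoc)
    then show "y = qcnj b * inverse q * qcnj b * x"
      using assms unit_quat_cnj[OF b] by simp
  next
    assume "y = qcnj b * inverse q * qcnj b * x"
    then have "q * (b * y) = q * (b * qcnj b) * inverse q * qcnj b * x"
      by (simp add: mult.assoc)
    then show "qcnj b * x = q * (b * y)"
      using assms unit_quat_cnj[OF b] by simp
  qed
  then show ?thesis
    unfolding image_mult_vec[OF swap_involution[OF b] swap_involution[OF b]]
    by (simp add: set_eq_iff swap_mat_def mat2_vector mem_line)
qed

lemma swap_line_0:
  assumes b: "qdot b b = 1"
  shows "(*v) (swap_mat b) ` line 0 = line_inf" "(*v) (swap_mat b) ` line_inf = line 0"
  unfolding image_mult_vec[OF swap_involution[OF b] swap_involution[OF b]]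
  using unit_quat_nonzero[OF b]
  by (simp_all add: set_eq_iff swap_mat_def mat2_vector mem_line mem_line_inf)

lemma dil_line:
  assumes h: "qdot h h = 1"
  shows "(*v) (dil_mat h) ` line q = line (q * qcnj h)"
  unfolding image_mult_vec[OF dil_inverse(2,1)[OF h]]
  by (simp add: set_eq_iff dil_mat_def mat2_vector mem_line mult.assoc)

text \<open>The condition in the definition of a system of imprimitivity need only be checked on
generators: it is preserved by products, and also by inverses because it asks for equality.\<close>

lemma permuted_by_generate:
  fixes X :: "(quat^2^2) set"
  assumes X: "X \<subseteq> carrier GL"
  shows "(\<forall>g\<in>generate GL X. (\<lambda>V. (*v) g ` V) ` S = S) \<longleftrightarrow>
         (\<forall>g\<in>X. (\<lambda>V. (*v) g ` V) ` S = S)"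
proof
  assume *: "\<forall>g\<in>X. (\<lambda>V. (*v) g ` V) ` S = S"
  have comp: "(\<lambda>V. (*v) (g ** h) ` V) ` S = (\<lambda>V. (*v) g ` V) ` (\<lambda>V. (*v) h ` V) ` S"
    for g h :: "quat^2^2"
    by (simp add: image_image flip: matrix_vector_mul_assoc)
  have one: "(\<lambda>V. (*v) (mat 1 :: quat^2^2) ` V) ` S = S" by simp
  show "\<forall>g\<in>generate GL X. (\<lambda>V. (*v) g ` V) ` S = S"
  proof
    fix g assume "g \<in> generate GL X"
    then show "(\<lambda>V. (*v) g ` V) ` S = S"
    proof induction
      case one then show ?case using one by simp
    next
      case (incl h) then show ?case using * by blast
    next
      case (inv h)
      then have "(inv\<^bsub>GL\<^esub> h) ** h = mat 1"
        using group.l_inv[OF group_GL, of h] X by auto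
      then show ?case using comp[of "inv\<^bsub>GL\<^esub> h" h] * inv one by simp
    next
      case (eng g h) then show ?case using comp[of g h] by simp
    qed
  qed
qed (blast intro: generate.incl)


section \<open>Additional systems as pairs of nonzero quaternions\<close>

text \<open>A system that contains \<open>line 0\<close> or \<open>line_inf\<close> contains both, because the reflection with parameter
\<open>1\<close> exchanges them, and so it is the standard system. Any two different lines are
complementary, so that beyond this only invariance under the generators is left.\<close>

lemma additional_systems_iff:
  assumes L: "\<forall>b\<in>L. qdot b b = 1" and H: "\<forall>h\<in>H. qdot h h = 1" and "1 \<in> L"
  shows "S \<in> additional_systems (QG L H) \<longleftrightarrow>
    (\<exists>p q. p \<noteq> q \<and> p \<noteq> 0 \<and> q \<noteq> 0 \<and> S = {line p, line q} \<and>
      (\<forall>b\<in>L. {qcnj b * inverse p * qcnj b, qcnj b * inverse q * qcnj b} = {p, q}) \<and>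
      (\<forall>h\<in>H. {p * qcnj h, q * qcnj h} = {p, q}))"
  (is "?lhs \<longleftrightarrow> (\<exists>p q. ?P p q)")
proof -
  have perm: "(\<forall>g\<in>QG L H. (\<lambda>V. (*v) g ` V) ` S = S) \<longleftrightarrow>
    (\<forall>b\<in>L. (\<lambda>V. (*v) (swap_mat b) ` V) ` S = S) \<and> (\<forall>h\<in>H. (\<lambda>V. (*v) (dil_mat h) ` V) ` S = S)" for S
    unfolding QG_eq permuted_by_generate[OF QG_generators_carrier[OF L H]] by blast
  have lines: "{line a, line b} = {line c, line d} \<longleftrightarrow> {a, b} = {c, d}" for a b c d
    by (auto simp: doubleton_eq_iff)
  have act: "(\<forall>g\<in>QG L H. (\<lambda>V. (*v) g ` V) ` {line p, line q} = {line p, line q}) \<longleftrightarrow>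
      (\<forall>b\<in>L. {qcnj b * inverse p * qcnj b, qcnj b * inverse q * qcnj b} = {p, q}) \<and>
      (\<forall>h\<in>H. {p * qcnj h, q * qcnj h} = {p, q})" if "p \<noteq> 0" "q \<noteq> 0" for p q
    unfolding perm using that L H by (auto simp: swap_line dil_line lines)
  show ?thesis
  proof
    assume ?lhs
    then have sys: "imprimitivity_system (QG L H) S" and additional: "S \<noteq> standard_system"
      by (simp_all add: additional_systems_def)
    from sys have G: "\<forall>g\<in>QG L H. (\<lambda>V. (*v) g ` V) ` S = S"
      unfolding imprimitivity_system_def by (rule conjunct2)
    from sys have "\<exists>V1 V2. S = {V1, V2} \<and> one_dim_subspace V1 \<and> one_dim_subspace V2 \<and>
        V1 \<inter> V2 = {0} \<and> {x + y |x y. x \<in> V1 \<and> y \<in> V2} = UNIV"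
      unfolding imprimitivity_system_def by (rule conjunct1)
    then obtain V1 V2 where S: "S = {V1, V2}" and
      V: "one_dim_subspace V1" "one_dim_subspace V2" "V1 \<inter> V2 = {0}"
      by metis
    have "(\<lambda>V. (*v) (swap_mat 1) ` V) ` S = S" using G \<open>1 \<in> L\<close> unfolding perm by simp
    moreover have "qdot 1 1 = 1" by (simp add: qdot_def)
    ultimately have "line 0 \<in> S \<longleftrightarrow> line_inf \<in> S"
      using swap_line_0[of 1] imageI[of _ S "\<lambda>V. (*v) (swap_mat 1) ` V"] by metis
    moreover have "S = standard_system" if "line 0 \<in> S" "line_inf \<in> S"
      using that line_neq_inf(1)[of 0] unfolding S standard_system_eq
      by (elim insertE emptyE) (simp_all add: insert_commute)
    ultimately have nonstd: "line 0 \<notin> S" "line_inf \<notin> S"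
      using additional by metis+
    from V(1,2) nonstd S obtain p q where pq: "V1 = line p" "V2 = line q"
      unfolding one_dim_subspace_iff by blast
    have nz: "p \<noteq> 0" "q \<noteq> 0" using nonstd S pq by auto
    have "p \<noteq> q" using V(3) pq line_not_trivial(1) by auto
    moreover have S': "S = {line p, line q}" using S pq by simp
    ultimately show "\<exists>p q. ?P p q"
      using nz G[unfolded S' act[OF nz]] by (intro exI[of _ p] exI[of _ q] conjI) simp_all
  next
    assume "\<exists>p q. ?P p q"
    then obtain p q where pq: "p \<noteq> q" "p \<noteq> 0" "q \<noteq> 0" and S: "S = {line p, line q}" and
      inv: "(\<forall>b\<in>L. {qcnj b * inverse p * qcnj b, qcnj b * inverse q * qcnj b} = {p, q}) \<and>
        (\<forall>h\<in>H. {p * qcnj h, q * qcnj h} = {p, q})"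
      by (elim exE conjE) (rule that; simp)
    have "S \<noteq> standard_system" using S by (auto simp: standard_system_eq doubleton_eq_iff)
    moreover have "\<exists>V1 V2. S = {V1, V2} \<and> one_dim_subspace V1 \<and> one_dim_subspace V2 \<and>
        V1 \<inter> V2 = {0} \<and> {x + y |x y. x \<in> V1 \<and> y \<in> V2} = UNIV"
      using S lines_complementary[OF pq(1)]
      by (intro exI[of _ "line p"] exI[of _ "line q"] conjI) (auto simp: one_dim_subspace_iff)
    moreover have "\<forall>g\<in>QG L H. (\<lambda>V. (*v) g ` V) ` S = S"
      unfolding S act[OF pq(2,3)] by (rule inv)
    ultimately show ?lhs
      unfolding additional_systems_def imprimitivity_system_def by (intro CollectI conjI)
  qed
qed


section \<open>Reduction to pure quaternions\<close>

text \<open>The first alternative of the right-hand side says that the reflection with parameter \<open>b\<close>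
exchanges \<open>line p\<close> with \<open>line (inverse p)\<close> in the same way as the one with parameter \<open>1\<close>, the second
that it fixes both lines. Fixing \<open>line p\<close> means \<open>(b p)\<^sup>2 = 1\<close>, that is, \<open>p = \<plusminus> b'\<close>; fixing the other
line means \<open>p = \<plusminus> b\<close>; and a real \<open>b\<close> is excluded by \<open>p \<noteq> p\<^sup>-\<^sup>1\<close>.\<close>

lemma pair_permuted_iff:
  assumes b: "qdot b b = 1" and p: "p \<noteq> 0" "p \<noteq> inverse p"
  shows "{qcnj b * inverse p * qcnj b, qcnj b * inverse (inverse p) * qcnj b} = {p, inverse p} \<longleftrightarrow>
    b * p = p * qcnj b \<or> (b = p \<or> b = - p) \<and> qcnj b = - b"
proof -
  note bu = unit_quat_cnj[OF b] unit_quat_cancel[OF b] unit_quat_nonzero[OF b]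
  have inv_b: "inverse b = qcnj b" "inverse (qcnj b) = b"
    using bu(1,2) by (metis inverse_unique)+
  have cancel_b: "qcnj b * x = y \<longleftrightarrow> x = b * y" "x * qcnj b = y \<longleftrightarrow> x = y * b" for x y
    using bu by (auto simp: mult.assoc)
  have cancel_b': "b * x = y \<longleftrightarrow> x = qcnj b * y" for x y
    using bu by auto
  have cancel_p: "inverse p * x = y \<longleftrightarrow> x = p * y" for x y
    using p(1) by (auto simp flip: mult.assoc)
  have fixes1: "qcnj b * p * qcnj b = p \<longleftrightarrow> b * p = p * qcnj b"
    using bu by (metis cancel_b(1) mult.assoc)
  have fixes2: "qcnj b * inverse p * qcnj b = inverse p \<longleftrightarrow> b * p = p * qcnj b"
  proof -
    have "qcnj b * inverse p * qcnj b = inverse p \<longleftrightarrow> inverse (b * p * b) = inverse p"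
      using inv_b by (simp add: nonzero_inverse_mult_distrib p(1) bu(5) mult.assoc)
    also have "\<dots> \<longleftrightarrow> b * p * b = p" by simp
    also have "\<dots> \<longleftrightarrow> b * p = p * qcnj b" using cancel_b(2) by metis
    finally show ?thesis .
  qed
  have moves1: "qcnj b * p * qcnj b = inverse p \<longleftrightarrow> p = b \<or> p = - b"
  proof -
    have "qcnj b * p * qcnj b = inverse p \<longleftrightarrow> (qcnj b * p) * (qcnj b * p) = 1"
      using p(1) by (metis left_inverse mult.assoc mult_cancel_right)
    also have "\<dots> \<longleftrightarrow> qcnj b * p = 1 \<or> qcnj b * p = - 1" by (rule square_eq_1_iff)
    also have "\<dots> \<longleftrightarrow> p = b \<or> p = - b" by (simp add: cancel_b)
    finally show ?thesis .
  qed
  have moves2: "qcnj b * inverse p * qcnj b = p \<longleftrightarrow> p = qcnj b \<or> p = - qcnj b"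
  proof -
    have "qcnj b * inverse p * qcnj b = p \<longleftrightarrow> inverse p * qcnj b = b * p"
      by (simp only: cancel_b(1) mult.assoc)
    also have "\<dots> \<longleftrightarrow> qcnj b * 1 = p * (b * p)" by (simp only: cancel_p mult_1_right)
    also have "\<dots> \<longleftrightarrow> 1 = b * (p * (b * p))" by (rule cancel_b(1))
    also have "\<dots> \<longleftrightarrow> (b * p) * (b * p) = 1" by (auto simp: mult.assoc)
    also have "\<dots> \<longleftrightarrow> b * p = 1 \<or> b * p = - 1" by (rule square_eq_1_iff)
    also have "\<dots> \<longleftrightarrow> p = qcnj b \<or> p = - qcnj b"
      by (simp add: cancel_b')
    finally show ?thesis .
  qed
  have "(p = b \<or> p = - b) \<and> (p = qcnj b \<or> p = - qcnj b) \<longleftrightarrow> (b = p \<or> b = - p) \<and> qcnj b = - b"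
  proof -
    have "b \<noteq> p \<and> b \<noteq> - p" if "qcnj b = b"
      using bu(2) that p by (metis inverse_minus_eq inverse_unique minus_minus)
    then show ?thesis by (metis minus_minus)
  qed
  then show ?thesis
    unfolding doubleton_eq_iff inverse_inverse_eq fixes1 fixes2 moves1 moves2 by blast
qed

lemma pure_neq_inverse:
  assumes "Re0 q = 0" "q \<noteq> 0"
  shows "q \<noteq> inverse q"
proof
  assume "q = inverse q"
  then have "q * q = 1" using assms(2) by (metis right_inverse)
  then show False using assms(1) square_eq_1_iff[of q] by (auto simp: quat_eq_iff)
qed

text \<open>For a pure \<open>q\<close> the line orthogonal to \<open>line q\<close> is also its image under the reflection
with parameter \<open>1\<close>. This is why all additional systems turn out to be orthogonal.\<close>

lemma system_of_pure:
  assumes "Re0 q = 0" "q \<noteq> 0"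
  shows "system_of q = {line q, line (inverse q)}"
proof -
  have "qcnj q = - q" using assms(1) by (simp add: quat_eq_iff)
  then show ?thesis using system_of_eq[OF assms(2)] by simp
qed

text \<open>The hypothesis on \<open>c\<close> is used twice. If the reflection with parameter \<open>1\<close> fixed both members of
the pair, the pair would be \<open>{1, - 1}\<close>, and \<open>c\<close> would have to satisfy \<open>c\<^sup>2 = \<plusminus> 1\<close>. Hence the pair is
\<open>{p, p\<^sup>-\<^sup>1}\<close>; and \<open>c\<close> cannot fix its two members, not being pure, so that it exchanges them and
makes \<open>p\<close> pure.\<close>

lemma additional_systems_pure:
  assumes L: "\<forall>b\<in>L. qdot b b = 1" and H: "\<forall>h\<in>H. qdot h h = 1" and "1 \<in> L"
    and c: "c \<in> L" "qcnj c \<noteq> c" "qcnj c \<noteq> - c"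
  shows "additional_systems (QG L H) = system_of ` {q. q \<noteq> 0 \<and> Re0 q = 0 \<and>
      (\<forall>b\<in>L. qdot b q = 0 \<or> b = q \<or> b = - q) \<and>
      (\<forall>h\<in>H. {q * qcnj h, inverse q * qcnj h} = {q, inverse q})}" (is "_ = system_of ` ?A")
proof (intro equalityI subsetI)
  fix S assume "S \<in> additional_systems (QG L H)"
  then obtain p q where pq: "p \<noteq> q" "p \<noteq> 0" "q \<noteq> 0" "S = {line p, line q}" and
    invL: "\<forall>b\<in>L. {qcnj b * inverse p * qcnj b, qcnj b * inverse q * qcnj b} = {p, q}" and
    invH: "\<forall>h\<in>H. {p * qcnj h, q * qcnj h} = {p, q}"
    unfolding additional_systems_iff[OF L H \<open>1 \<in> L\<close>] by metis
  have "qdot c c = 1" using L c by blast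
  note cu = unit_quat_cnj[OF this] unit_quat_cancel[OF this]
  have "q = inverse p"
  proof (rule ccontr)
    assume "q \<noteq> inverse p"
    moreover have "{inverse p, inverse q} = {p, q}" using bspec[OF invL \<open>1 \<in> L\<close>] by simp
    ultimately have "inverse p = p" "inverse q = q" by (auto simp: doubleton_eq_iff)
    then have "p * p = 1" "q * q = 1" using pq by (metis right_inverse)+
    then have "{p, q} = {1, - 1}" using pq(1) by (auto simp: square_eq_1_iff)
    then have "{qcnj c * qcnj c, - (qcnj c * qcnj c)} = {1, - 1}"
      using bspec[OF invL c(1)] by (auto simp: doubleton_eq_iff)
    then have "qcnj c * qcnj c = 1 \<or> qcnj c * qcnj c = - 1" by (auto simp: doubleton_eq_iff)
    then have "qcnj c = c \<or> qcnj c = - c" using cu(4) by (metis mult.right_neutral mult_minus_right)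
    then show False using c by blast
  qed
  have neq: "p \<noteq> inverse p" using pq(1) \<open>q = inverse p\<close> by simp
  have each: "b * p = p * qcnj b \<or> (b = p \<or> b = - p) \<and> qcnj b = - b" if "b \<in> L" for b
    using pair_permuted_iff[OF _ pq(2) neq] invL L that \<open>q = inverse p\<close> by blast
  have pure: "Re0 p = 0" using each[OF c(1)] c twisted_commuting_pure[of c p] by metis
  then have "qdot b p = 0 \<or> b = p \<or> b = - p" if "b \<in> L" for b
    using each[OF that] pure_swap_iff[OF pure] by blast
  then have "p \<in> ?A" using pure pq(2) invH \<open>q = inverse p\<close> by simp
  moreover have "S = system_of p"
    using system_of_pure[OF pure pq(2)] pq(4) \<open>q = inverse p\<close> by simp
  ultimately show "S \<in> system_of ` ?A" by (rule rev_image_eqI)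
next
  fix S assume "S \<in> system_of ` ?A"
  then obtain q where S: "S = system_of q" and q: "q \<noteq> 0" "Re0 q = 0"
    and qL: "\<forall>b\<in>L. qdot b q = 0 \<or> b = q \<or> b = - q"
    and qH: "\<forall>h\<in>H. {q * qcnj h, inverse q * qcnj h} = {q, inverse q}" by blast
  have neq: "q \<noteq> inverse q" using pure_neq_inverse q by blast
  have "qcnj q = - q" using q(2) by (simp add: quat_eq_iff)
  then have "b * q = q * qcnj b \<or> (b = q \<or> b = - q) \<and> qcnj b = - b" if "b \<in> L" for b
    using qL that pure_swap_iff[OF q(2)] by auto
  then have "{qcnj b * inverse q * qcnj b, qcnj b * inverse (inverse q) * qcnj b} = {q, inverse q}"
    if "b \<in> L" for b
    using pair_permuted_iff[OF _ q(1) neq] L that by blast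
  then show "S \<in> additional_systems (QG L H)"
    unfolding additional_systems_iff[OF L H \<open>1 \<in> L\<close>]
    using neq q(1) qH S system_of_pure[OF q(2,1)]
    by (intro exI[of _ q] exI[of _ "inverse q"] conjI ballI) simp_all
qed

text \<open>Applying \<open>diag(h, 1)\<close> twice would fix a nonzero quaternion \<open>p\<close>, but it maps \<open>p\<close> to \<open>p\<close> times
the conjugate of \<open>h\<^sup>2\<close>.\<close>

lemma no_additional_systems_if_homology:
  assumes L: "\<forall>b\<in>L. qdot b b = 1" and H: "\<forall>h\<in>H. qdot h h = 1" and "1 \<in> L"
    and h: "h \<in> H" "h * h \<noteq> 1"
  shows "additional_systems (QG L H) = {}"
proof -
  have False if "S \<in> additional_systems (QG L H)" for S
  proof -
    from that[unfolded additional_systems_iff[OF L H \<open>1 \<in> L\<close>]]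
    obtain p q where pq: "p \<noteq> 0" "q \<noteq> 0" and "\<forall>h\<in>H. {p * qcnj h, q * qcnj h} = {p, q}"
      by metis
    then have "p * qcnj h = p \<or> p * qcnj h = q \<and> q * qcnj h = p"
      using h(1) by (auto simp: doubleton_eq_iff)
    then have "p * (qcnj h * qcnj h) = p" by (auto simp flip: mult.assoc)
    then have "qcnj (h * h) = 1" using pq by simp
    then show False using h(2) by (simp add: qcnj_eq_iff del: qcnj_simps(5))
  qed
  then show ?thesis by blast
qed

lemma unit_pure_inverse:
  assumes "Re0 u = 0" "qdot u u = 1"
  shows "inverse u = - u"
  using pure_unit_square[OF assms(1)] assms(2) by (intro inverse_unique) simp


section \<open>Systems with proportional axes\<close>

lemma system_of_opposite_units:
  assumes u: "Re0 u = 0" "qdot u u = 1" and "A = {u, - u}"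
  shows "system_of ` A = {system_of u}"
proof -
  have nz: "u \<noteq> 0" using u by (auto simp: qdot_def)
  have "system_of (- u) = system_of u"
    using u nz system_of_pure[of u] system_of_pure[of "- u"] unit_pure_inverse[OF u]
    by (simp add: insert_commute)
  then show ?thesis using assms(3) by simp
qed

text \<open>For a pure unit \<open>u\<close> the inverse of \<open>\<alpha> u\<close> is \<open>- \<alpha>\<^sup>-\<^sup>1 u\<close>, so that the systems of \<open>\<alpha> u\<close> and \<open>\<beta> u\<close> agree
exactly if \<open>\<beta> = \<alpha>\<close> or \<open>\<beta> = - 1 / \<alpha>\<close>. The half-open interval without \<open>0\<close> contains exactly one element
of each class \<open>{\<alpha>, - 1 / \<alpha>}\<close>.\<close>

lemma system_of_multiples_bij:
  assumes u: "Re0 u = 0" "qdot u u = 1" and A: "A = {\<alpha> *\<^sub>R u | \<alpha>. \<alpha> \<noteq> 0}"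
  shows "bij_betw (\<lambda>\<alpha>. system_of (\<alpha> *\<^sub>R u)) {\<alpha>::real. - 1 < \<alpha> \<and> \<alpha> \<le> 1 \<and> \<alpha> \<noteq> 0} (system_of ` A)"
proof -
  have nz: "u \<noteq> 0" using u by (auto simp: qdot_def)
  have sys: "system_of (\<alpha> *\<^sub>R u) = {line (\<alpha> *\<^sub>R u), line ((- 1 / \<alpha>) *\<^sub>R u)}"
    if "\<alpha> \<noteq> 0" for \<alpha>
    using system_of_pure[of "\<alpha> *\<^sub>R u"] that nz u(1) unit_pure_inverse[OF u]
    by (simp add: divide_inverse nonzero_inverse_scaleR_distrib)
  have same: "system_of (\<alpha> *\<^sub>R u) = system_of (\<beta> *\<^sub>R u) \<longleftrightarrow> \<alpha> = \<beta> \<or> \<alpha> = - 1 / \<beta>"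
    if "\<alpha> \<noteq> 0" "\<beta> \<noteq> 0" for \<alpha> \<beta>
    unfolding sys[OF that(1)] sys[OF that(2)] doubleton_eq_iff line_inject scaleR_cancel_right
    using that nz by (auto simp: field_simps)
  have "\<alpha> = \<beta>" if "- 1 < \<alpha>" "\<alpha> \<le> 1" "\<alpha> \<noteq> 0" "- 1 < \<beta>" "\<beta> \<le> 1" "\<beta> \<noteq> 0" "\<alpha> = - 1 / \<beta>"
    for \<alpha> \<beta> :: real
  proof -
    have "\<alpha> * \<beta> = - 1" using that by simp
    then have one: "\<bar>\<alpha>\<bar> * \<bar>\<beta>\<bar> = 1" by (simp flip: abs_mult)
    have "\<bar>\<alpha>\<bar> * \<bar>\<beta>\<bar> \<le> \<bar>\<alpha>\<bar> * 1" using that by (intro mult_left_mono) auto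
    then have "1 \<le> \<bar>\<alpha>\<bar>" unfolding one by simp
    then have "\<alpha> = 1" using that(1,2) by linarith
    then show ?thesis using that(4,6) \<open>\<alpha> * \<beta> = - 1\<close> by simp
  qed
  then have "inj_on (\<lambda>\<alpha>. system_of (\<alpha> *\<^sub>R u)) {\<alpha>::real. - 1 < \<alpha> \<and> \<alpha> \<le> 1 \<and> \<alpha> \<noteq> 0}"
    by (auto simp: inj_on_def same)
  moreover have "\<exists>\<beta>. - 1 < \<beta> \<and> \<beta> \<le> 1 \<and> \<beta> \<noteq> 0 \<and> system_of (\<alpha> *\<^sub>R u) = system_of (\<beta> *\<^sub>R u)"
    if "\<alpha> \<noteq> 0" for \<alpha>
  proof (cases "- 1 < \<alpha> \<and> \<alpha> \<le> 1")
    case True then show ?thesis using that by blast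
  next
    case False
    then have "- 1 < - 1 / \<alpha> \<and> - 1 / \<alpha> \<le> 1" by (auto simp: field_simps)
    moreover have "- 1 / \<alpha> \<noteq> 0" using that by simp
    moreover have "system_of (\<alpha> *\<^sub>R u) = system_of ((- 1 / \<alpha>) *\<^sub>R u)"
      unfolding same[OF that \<open>- 1 / \<alpha> \<noteq> 0\<close>] using that by simp
    ultimately show ?thesis by blast
  qed
  ultimately show ?thesis unfolding A by (auto simp: bij_betw_def)
qed


section \<open>Axes of a set of reflection parameters\<close>

definition axis_condition :: "quat \<Rightarrow> quat \<Rightarrow> bool" where
  "axis_condition b q \<longleftrightarrow> qdot b q = 0 \<or> b = q \<or> b = - q"

definition axes :: "quat set \<Rightarrow> quat set" where
  "axes L = {q. q \<noteq> 0 \<and> Re0 q = 0 \<and> (\<forall>b\<in>L. axis_condition b q)}"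

lemma additional_systems_no_homology:
  assumes "\<forall>b\<in>L. qdot b b = 1" "1 \<in> L" "c \<in> L" "qcnj c \<noteq> c" "qcnj c \<noteq> - c"
  shows "additional_systems (QG L {}) = system_of ` axes L"
  using additional_systems_pure[of L "{}" c] assms
  by (simp add: axes_def axis_condition_def)

text \<open>The homology \<open>- 1\<close> sends \<open>q\<close> to \<open>- q\<close>, so it must exchange \<open>q\<close> with \<open>q\<^sup>-\<^sup>1\<close>; this says \<open>q\<^sup>2 = - 1\<close>.\<close>

lemma additional_systems_minus_one:
  assumes "\<forall>b\<in>L. qdot b b = 1" "1 \<in> L" "c \<in> L" "qcnj c \<noteq> c" "qcnj c \<noteq> - c"
  shows "additional_systems (QG L {- 1}) = system_of ` {q \<in> axes L. qdot q q = 1}"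
proof -
  have "{- q, - inverse q} = {q, inverse q} \<longleftrightarrow> qdot q q = 1" if "q \<noteq> 0" "Re0 q = 0" for q
  proof -
    have neg: "- q \<noteq> q" using that(1) by (auto simp: quat_eq_iff)
    have "{- q, - inverse q} = {q, inverse q} \<longleftrightarrow> - q = inverse q"
      unfolding doubleton_eq_iff using neg by (metis minus_minus)
    also have "\<dots> \<longleftrightarrow> q * q = - 1"
      using that(1) by (metis inverse_unique minus_minus mult_minus_right right_inverse)
    finally show ?thesis using pure_unit_square[OF that(2)] by blast
  qed
  moreover have "qdot (- 1) (- 1) = 1" by (simp add: qdot_def)
  ultimately show ?thesis
    using additional_systems_pure[of L "{- 1}" c] assms
    by (auto simp: axes_def axis_condition_def intro!: image_cong)
qed

text \<open>A parameter that is not orthogonal to a known normal vector \<open>n\<close> of \<open>q\<close> is not a multiple of \<open>q\<close>.\<close>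

lemma axis_condition_orthogonal:
  assumes "qdot n q = 0" "qdot n b \<noteq> 0"
  shows "axis_condition b q \<longleftrightarrow> qdot b q = 0"
  using assms by (auto simp: axis_condition_def qdot_def)


section \<open>The axes of the fifteen groups\<close>

lemma tau_sq: "tau * tau = tau + 1"
  by (simp add: tau_def field_simps)

lemma tau_sq': "tau * (tau * x) = tau * x + x"
  using tau_sq by (metis distrib_right mult.assoc mult_1)

lemma tau_bounds: "1 < tau" "tau < 2"
  by (auto simp: tau_def real_less_lsqrt)

definition qc :: quat where "qc = (1 + qi) /\<^sub>R sqrt 2"
definition qd :: quat where "qd = (1 + qj) /\<^sub>R sqrt 2"
definition qy :: quat where "qy = (qi + sigma *\<^sub>R qj + tau *\<^sub>R qk) /\<^sub>R 2"

lemmas quat_consts = qw_def qv_def qu_def qz_def qc_def qd_def qy_def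

lemma unit_consts:
  "qdot 1 1 = 1" "qdot qi qi = 1" "qdot qj qj = 1" "qdot qw qw = 1" "qdot qv qv = 1"
  "qdot qu qu = 1" "qdot qz qz = 1" "qdot qc qc = 1" "qdot qd qd = 1" "qdot qy qy = 1"
  by (simp_all add: qdot_def quat_consts sigma_def field_simps tau_sq tau_sq')

lemma pure_consts: "Re0 qu = 0" "Re0 qz = 0"
  by (simp_all add: quat_consts)

lemma qw_not_pure_not_real: "qcnj qw \<noteq> qw" "qcnj qw \<noteq> - qw"
  by (simp_all add: quat_consts quat_eq_iff)

lemma orthogonal_one_qw:
  assumes "1 \<in> L" "qw \<in> L" "q \<in> axes L"
  shows "qdot 1 q = 0" "qdot qw q = 0"
proof -
  show one: "qdot 1 q = 0" using assms by (simp add: axes_def qdot_def)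
  moreover have "qdot 1 qw \<noteq> 0" by (simp add: qdot_def quat_consts)
  ultimately show "qdot qw q = 0"
    using axis_condition_orthogonal assms by (auto simp: axes_def)
qed

text \<open>With \<open>1\<close> and \<open>w\<close> as normal vectors, only pure parameters orthogonal to \<open>w\<close> can be axes;
every other parameter imposes a linear condition.\<close>

lemma axes_insert_transverse:
  assumes "1 \<in> L" "qw \<in> L" "qdot 1 b \<noteq> 0 \<or> qdot qw b \<noteq> 0"
  shows "axes (insert b L) = {q \<in> axes L. qdot b q = 0}"
proof -
  have "axis_condition b q \<longleftrightarrow> qdot b q = 0" if "q \<in> axes L" for q
    using orthogonal_one_qw[OF assms(1,2) that] axis_condition_orthogonal assms(3) by blast
  then show ?thesis by (auto simp: axes_def)
qed

lemma axes_insert_axis: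
  assumes "axes L = {\<alpha> *\<^sub>R u | \<alpha>. \<alpha> \<noteq> 0}" "qdot u u = 1"
  shows "axes (insert u L) = {u, - u}"
proof -
  have nz: "u \<noteq> 0" using assms(2) by (auto simp: qdot_def)
  have "axis_condition u (\<alpha> *\<^sub>R u) \<longleftrightarrow> \<alpha> = 1 \<or> \<alpha> = - 1" if "\<alpha> \<noteq> 0" for \<alpha>
  proof -
    have "qdot u (\<alpha> *\<^sub>R u) = \<alpha> * qdot u u" by (simp add: qdot_def algebra_simps)
    moreover have "u = \<alpha> *\<^sub>R u \<longleftrightarrow> \<alpha> = 1" "u = - (\<alpha> *\<^sub>R u) \<longleftrightarrow> \<alpha> = - 1"
      using nz scaleR_cancel_right[of 1 u \<alpha>] scaleR_cancel_right[of 1 u "- \<alpha>"] by auto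
    ultimately show ?thesis using that assms(2) by (simp add: axis_condition_def)
  qed
  then have "axis_condition u (\<alpha> *\<^sub>R u) \<longleftrightarrow> \<alpha> *\<^sub>R u \<in> {u, - u}" if "\<alpha> \<noteq> 0" for \<alpha>
    using that nz scaleR_cancel_right[of \<alpha> u 1] scaleR_cancel_right[of \<alpha> u "- 1"] by simp
  then have condition: "axis_condition u q \<longleftrightarrow> q \<in> {u, - u}" if "q \<in> axes L" for q
    using that unfolding assms(1) by fast
  have "u \<in> axes L" unfolding assms(1) by (intro CollectI exI[of _ 1]) simp
  moreover have "- u \<in> axes L" unfolding assms(1) by (intro CollectI exI[of _ "- 1"]) simp
  ultimately have sub: "{u, - u} \<subseteq> axes L" by simp
  have "axes (insert u L) = {q \<in> axes L. axis_condition u q}" by (auto simp: axes_def)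
  also have "\<dots> = {q \<in> axes L. q \<in> {u, - u}}" using condition by blast
  also have "\<dots> = {u, - u}" using sub by blast
  finally show ?thesis .
qed

lemma axes_one_qw: "axes {1, qw} = {q. q \<noteq> 0 \<and> Re0 q = 0 \<and> Im1 q + Im2 q + Im3 q = 0}"
proof -
  have "axis_condition qw q \<longleftrightarrow> qdot qw q = 0" if "Re0 q = 0" for q
    using that axis_condition_orthogonal[of 1 q qw] by (simp add: qdot_def quat_consts)
  moreover have "axis_condition 1 q" if "Re0 q = 0" for q
    using that by (simp add: axis_condition_def qdot_def)
  ultimately show ?thesis
    by (auto simp: axes_def qdot_def quat_consts)
qed

lemma multiples_qu:
  "{q. q \<noteq> 0 \<and> Re0 q = 0 \<and> Im1 q + Im2 q + Im3 q = 0 \<and> Im1 q = 0} = {\<alpha> *\<^sub>R qu | \<alpha>. \<alpha> \<noteq> 0}"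
proof (intro equalityI subsetI)
  fix q assume "q \<in> {q. q \<noteq> 0 \<and> Re0 q = 0 \<and> Im1 q + Im2 q + Im3 q = 0 \<and> Im1 q = 0}"
  then have "q = (sqrt 2 * Im2 q) *\<^sub>R qu" "sqrt 2 * Im2 q \<noteq> 0"
    by (auto simp: quat_eq_iff quat_consts field_simps)
  then show "q \<in> {\<alpha> *\<^sub>R qu | \<alpha>. \<alpha> \<noteq> 0}" by blast
qed (auto simp: quat_eq_iff quat_consts)

text \<open>The two linear conditions determine the direction \<open>(- \<tau>, 1, - \<sigma>)\<close>, the cross product of
\<open>(\<sigma>, - 1, 0)\<close> and \<open>(1, 1, 1)\<close> multiplied by \<open>\<tau>\<close>; here \<open>\<sigma> \<tau> = - 1\<close>.\<close>

lemma multiples_qz: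
  "{q. q \<noteq> 0 \<and> Re0 q = 0 \<and> Im1 q + Im2 q + Im3 q = 0 \<and> sigma * Im1 q = Im2 q} =
    {\<alpha> *\<^sub>R qz | \<alpha>. \<alpha> \<noteq> 0}"
proof (intro equalityI subsetI)
  fix q assume "q \<in> {q. q \<noteq> 0 \<and> Re0 q = 0 \<and> Im1 q + Im2 q + Im3 q = 0 \<and> sigma * Im1 q = Im2 q}"
  then have q: "q \<noteq> 0" "Re0 q = 0" "Im1 q + Im2 q + Im3 q = 0" "Im2 q = sigma * Im1 q"
    by auto
  have "Im1 q = - (tau * Im2 q)" by (simp add: q(4) sigma_def algebra_simps tau_sq tau_sq')
  with q(2,3) have "q = (2 * Im2 q) *\<^sub>R qz"
    by (simp add: quat_eq_iff quat_consts sigma_def algebra_simps)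
  moreover from this have "2 * Im2 q \<noteq> 0" using q(1) by auto
  ultimately show "q \<in> {\<alpha> *\<^sub>R qz | \<alpha>. \<alpha> \<noteq> 0}" by blast
qed (auto simp: quat_eq_iff quat_consts sigma_def algebra_simps tau_sq tau_sq')

lemma axes_qi: "axes {qi, 1, qw} = {\<alpha> *\<^sub>R qu | \<alpha>. \<alpha> \<noteq> 0}"
proof -
  have "axes {qi, 1, qw} = {q \<in> axes {1, qw}. qdot qi q = 0}"
    by (intro axes_insert_transverse) (simp_all add: qdot_def quat_consts)
  moreover have "qdot qi q = 0 \<longleftrightarrow> Im1 q = 0" if "Re0 q = 0" for q
    using that by (simp add: qdot_def quat_consts field_simps)
  ultimately show ?thesis
    unfolding axes_one_qw multiples_qu[symmetric] by auto
qed

lemma axes_qc: "axes {qc, 1, qw} = {\<alpha> *\<^sub>R qu | \<alpha>. \<alpha> \<noteq> 0}"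
proof -
  have "axes {qc, 1, qw} = {q \<in> axes {1, qw}. qdot qc q = 0}"
    by (intro axes_insert_transverse) (simp_all add: qdot_def quat_consts)
  moreover have "qdot qc q = 0 \<longleftrightarrow> Im1 q = 0" if "Re0 q = 0" for q
    using that by (simp add: qdot_def quat_consts field_simps)
  ultimately show ?thesis
    unfolding axes_one_qw multiples_qu[symmetric] by auto
qed

lemma axes_qv: "axes {qv, 1, qw} = {\<alpha> *\<^sub>R qz | \<alpha>. \<alpha> \<noteq> 0}"
proof -
  have "axes {qv, 1, qw} = {q \<in> axes {1, qw}. qdot qv q = 0}"
    using tau_bounds by (intro axes_insert_transverse) (simp_all add: qdot_def quat_consts)
  moreover have "qdot qv q = 0 \<longleftrightarrow> sigma * Im1 q = Im2 q" if "Re0 q = 0" for q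
    using that by (simp add: qdot_def quat_consts field_simps)
  ultimately show ?thesis
    unfolding axes_one_qw multiples_qz[symmetric] by auto
qed

lemma axes_empty:
  assumes "axes L = {\<alpha> *\<^sub>R u | \<alpha>. \<alpha> \<noteq> 0}" "1 \<in> L" "qw \<in> L"
    and "qdot 1 b \<noteq> 0 \<or> qdot qw b \<noteq> 0" "qdot b u \<noteq> 0"
  shows "axes (insert b L) = {}"
proof -
  have "qdot b (\<alpha> *\<^sub>R u) = \<alpha> * qdot b u" for \<alpha> by (simp add: qdot_def algebra_simps)
  then show ?thesis unfolding axes_insert_transverse[OF assms(2-4)] assms(1) using assms(5) by auto
qed


section \<open>Conjugation and generated matrix groups\<close>

lemma matrix_inv_eq:
  fixes P Q :: "'a::semiring_1^'n^'n"
  assumes "P ** Q = mat 1" "Q ** P = mat 1"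
  shows "matrix_inv P = Q"
proof -
  have "P ** matrix_inv P = mat 1 \<and> matrix_inv P ** P = mat 1"
    unfolding matrix_inv_def by (rule someI[of _ Q]) (simp add: assms)
  then show ?thesis using assms by (metis matrix_mul_assoc matrix_mul_lid matrix_mul_rid)
qed

lemma generate_conjugate:
  fixes P Q :: "'a::semiring_1^'n^'n"
  assumes PQ: "P ** Q = mat 1" "Q ** P = mat 1" and X: "X \<subseteq> carrier GL"
  shows "(\<lambda>A. P ** A ** Q) ` generate GL X = generate GL ((\<lambda>A. P ** A ** Q) ` X)"
proof -
  have "invertible P" "invertible Q" using PQ by (auto simp: invertible_def)
  then have "P ** A ** Q \<in> carrier GL" if "A \<in> carrier GL" for A
    using that by (simp add: carrier_GL invertible_mult)
  moreover have "P ** (A ** B) ** Q = (P ** A ** Q) ** (P ** B ** Q)" for A B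
    using PQ by (metis matrix_mul_assoc matrix_mul_rid)
  ultimately have "(\<lambda>A. P ** A ** Q) \<in> hom GL GL" by (auto simp: hom_def)
  then interpret group_hom GL GL "\<lambda>A. P ** A ** Q"
    by (simp add: group_hom_def group_hom_axioms_def group_GL)
  show ?thesis using generate_img[OF X] by simp
qed

lemma quat_of_complex_hom:
  "quat_of_complex 0 = 0" "quat_of_complex 1 = 1"
  "quat_of_complex (x + y) = quat_of_complex x + quat_of_complex y"
  "quat_of_complex (x * y) = quat_of_complex x * quat_of_complex y"
  by (simp_all add: quat_of_complex_def quat_eq_iff)

lemma quat_matrix_hom:
  "quat_matrix (A ** B) = quat_matrix A ** quat_matrix B" "quat_matrix (mat 1) = mat 1"
  by (simp_all add: quat_matrix_def matrix_matrix_mult_def mat_def vec_eq_iff sum_2 quat_of_complex_hom)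

lemma quat_matrix_mat2: "quat_matrix (mat2 a b c d) =
    mat2 (quat_of_complex a) (quat_of_complex b) (quat_of_complex c) (quat_of_complex d)"
  by (simp add: quat_matrix_def mat2_def vec_eq_iff forall_2)

lemma generate_quat_matrix:
  assumes X: "X \<subseteq> carrier GL"
  shows "quat_matrix ` generate GL X = generate GL (quat_matrix ` X)"
proof -
  have "quat_matrix A \<in> carrier GL" if "A \<in> carrier GL" for A
    using that unfolding carrier_GL invertible_def by (metis quat_matrix_hom)
  then have "quat_matrix \<in> hom GL GL" by (auto simp: hom_def quat_matrix_hom)
  then interpret group_hom GL GL quat_matrix
    by (simp add: group_hom_def group_hom_axioms_def group_GL)
  show ?thesis using generate_img[OF X] by simp
qed

lemma generate_GL_mult:
  "A \<in> generate GL X \<Longrightarrow> B \<in> generate GL X \<Longrightarrow> A ** B \<in> generate GL X"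
  using generate.eng[of A GL X B] by simp

lemma generate_GL_eqI:
  assumes "X \<subseteq> carrier GL" "Y \<subseteq> carrier GL" "X \<subseteq> generate GL Y" "Y \<subseteq> generate GL X"
  shows "generate GL X = generate GL Y"
proof -
  interpret group GL by (rule group_GL)
  show ?thesis
    using assms generate_subgroup_incl generate_is_subgroup by (metis equalityI)
qed

text \<open>If \<open>Q\<close> carries each reflection to a matrix \<open>M b\<close>, it carries the group to the one generated by these
matrices; so it suffices to express the two generating sets in terms of each other.\<close>

lemma GL_conjugate_QG:
  fixes P Q :: "quat^2^2"
  assumes PQ: "P ** Q = mat 1" "Q ** P = mat 1"
    and L: "\<forall>b\<in>L. qdot b b = 1"
    and M: "\<And>b. b \<in> L \<Longrightarrow> swap_mat b ** Q = Q ** M b"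
    and Y: "\<And>B. B \<in> Y \<Longrightarrow> B ** B = mat 1"
    and sub: "M ` L \<subseteq> generate GL (quat_matrix ` Y)" "quat_matrix ` Y \<subseteq> generate GL (M ` L)"
  shows "GL_conjugate (QG L {}) (quat_matrix ` generate GL Y)"
proof -
  have gens: "swap_mat ` L \<subseteq> carrier GL" using QG_generators_carrier[of L "{}"] L by simp
  have Y': "Y \<subseteq> carrier GL" using Y unfolding subset_iff carrier_GL invertible_def by blast
  have conj: "P ** swap_mat b ** Q = M b" if "b \<in> L" for b
    using M[OF that] PQ by (metis matrix_mul_assoc matrix_mul_lid)
  have "M b \<in> carrier GL" if "b \<in> L" for b
  proof -
    have "M b ** M b = P ** (swap_mat b ** (Q ** P) ** swap_mat b) ** Q"
      using conj[OF that] by (metis matrix_mul_assoc)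
    also have "\<dots> = mat 1" using swap_involution L that PQ by (simp add: matrix_mul_assoc)
    finally show ?thesis unfolding carrier_GL invertible_def by blast
  qed
  then have M_carrier: "M ` L \<subseteq> carrier GL" by auto
  have qY: "quat_matrix ` Y \<subseteq> carrier GL"
  proof -
    have "quat_matrix B ** quat_matrix B = mat 1" if "B \<in> Y" for B
      using Y[OF that] by (simp flip: quat_matrix_hom)
    then show ?thesis unfolding subset_iff carrier_GL invertible_def by blast
  qed
  have "(\<lambda>A. P ** A ** Q) ` QG L {} = generate GL ((\<lambda>A. P ** A ** Q) ` swap_mat ` L)"
    using generate_conjugate[OF PQ gens] by (simp add: QG_eq)
  also have "(\<lambda>A. P ** A ** Q) ` swap_mat ` L = M ` L"
    by (simp add: image_image conj cong: image_cong)
  also have "generate GL (M ` L) = generate GL (quat_matrix ` Y)"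
    by (rule generate_GL_eqI[OF M_carrier qY sub])
  also have "\<dots> = quat_matrix ` generate GL Y" using generate_quat_matrix[OF Y'] by simp
  finally have "quat_matrix ` generate GL Y = (\<lambda>A. P ** A ** matrix_inv P) ` QG L {}"
    by (simp add: matrix_inv_eq[OF PQ])
  moreover have "invertible P" using PQ by (auto simp: invertible_def)
  ultimately show ?thesis unfolding GL_conjugate_def by blast
qed


section \<open>Base changes to complex matrices\<close>

lemma inv_sqrt2_sq: "inverse (sqrt 2) * inverse (sqrt 2) = 1 / 2"
  "inverse (sqrt 2) * (inverse (sqrt 2) * x) = x / 2"
proof -
  show *: "inverse (sqrt 2) * inverse (sqrt 2) = 1 / 2" by (simp flip: inverse_mult_distrib)
  show "inverse (sqrt 2) * (inverse (sqrt 2) * x) = x / 2" by (simp add: * flip: mult.assoc)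
qed

text \<open>In terms of the Pauli matrices, \<open>st_r1\<close>, \<open>st_r2\<close>, \<open>st_r3\<close>, \<open>st_e1\<close>, \<open>st_e3\<close>, \<open>st_p\<close> are the unit vectors
\<open>(-1, 0, 1) / \<surd>2\<close>, \<open>(1, 0, 1) / \<surd>2\<close>, \<open>(1, -1, 0) / \<surd>2\<close>, \<open>(1, 0, 0)\<close>, \<open>(0, 0, 1)\<close> and \<open>(1, \<sigma>, \<tau>) / 2\<close>.\<close>

abbreviation st_r1 :: "complex^2^2" where
  "st_r1 \<equiv> mat2 (1 / sqrt 2) (- 1 / sqrt 2) (- 1 / sqrt 2) (- 1 / sqrt 2)"

abbreviation st_r2 :: "complex^2^2" where
  "st_r2 \<equiv> mat2 (1 / sqrt 2) (1 / sqrt 2) (1 / sqrt 2) (- 1 / sqrt 2)"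

abbreviation st_r3 :: "complex^2^2" where
  "st_r3 \<equiv> mat2 0 ((1 + \<i>) / sqrt 2) ((1 - \<i>) / sqrt 2) 0"

abbreviation st_e1 :: "complex^2^2" where
  "st_e1 \<equiv> mat2 0 1 1 0"

abbreviation st_e3 :: "complex^2^2" where
  "st_e3 \<equiv> mat2 1 0 0 (- 1)"

abbreviation st_p :: "complex^2^2" where
  "st_p \<equiv> mat2 (tau / 2) ((1 + (tau - 1) * \<i>) / 2) ((1 - (tau - 1) * \<i>) / 2) (- tau / 2)"

definition qh :: quat where "qh = inverse (sqrt 2) *\<^sub>R 1"

lemma quat_matrix_G12_G13:
  "quat_matrix st_r1 = mat2 qh (- qh) (- qh) (- qh)"
  "quat_matrix st_r2 = mat2 qh qh qh (- qh)"
  "quat_matrix st_r3 = mat2 0 qc (qcnj qc) 0"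
  "quat_matrix st_e3 = mat2 1 0 0 (- 1)"
  by (simp_all add: quat_matrix_mat2 quat_of_complex_def qh_def qc_def quat_eq_iff inverse_eq_divide)

text \<open>The factor \<open>a\<close> of the base change below, chosen to satisfy \<open>a i = - j a\<close>.\<close>

definition oct_axis :: quat where "oct_axis = qi - qj"

text \<open>Write \<open>c = (1 + i) / \<surd>2\<close>. The first column is fixed by the reflection with parameter \<open>c'\<close>, and the
second one is the negative of its image under the reflection with parameter \<open>c\<close>; as \<open>c\<close> and \<open>c'\<close>
are orthogonal, these reflections become the diagonal matrix and the negative of the
permutation matrix. The relation \<open>a i = - j a\<close> makes each column \<open>x\<close> satisfy \<open>J x = - x i\<close> for the
matrix \<open>J\<close> with rows \<open>(0, u)\<close> and \<open>(u, 0)\<close>.\<close>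

definition oct_basis :: "quat^2^2" where
  "oct_basis = mat2 (qcnj qc * oct_axis) (- (qc * oct_axis)) oct_axis (qi * oct_axis)"

text \<open>The conjugate transpose of \<open>oct_basis\<close>, divided by the squared length \<open>4\<close> of its columns.\<close>

definition oct_basis_inv :: "quat^2^2" where
  "oct_basis_inv = mat2 (qcnj oct_axis * qc /\<^sub>R 4) (qcnj oct_axis /\<^sub>R 4)
     (- (qcnj oct_axis * qcnj qc) /\<^sub>R 4) (- (qcnj oct_axis * qi) /\<^sub>R 4)"

lemma oct_basis_inverse:
  "oct_basis ** oct_basis_inv = mat 1" "oct_basis_inv ** oct_basis = mat 1"
  by (simp_all add: oct_basis_def oct_basis_inv_def mat_1_mat2 quat_eq_iff oct_axis_def qc_def
      algebra_simps inv_sqrt2_sq)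

lemma swap_oct_basis:
  "swap_mat 1 ** oct_basis = oct_basis ** mat2 qh (- qh) (- qh) (- qh)"
  "swap_mat qi ** oct_basis = oct_basis ** mat2 (- qh) (- qh) (- qh) qh"
  "swap_mat qw ** oct_basis = oct_basis ** mat2 0 (- qc) (- qcnj qc) 0"
  "swap_mat qc ** oct_basis = oct_basis ** mat2 0 (- 1) (- 1) 0"
  by (simp_all add: oct_basis_def swap_mat_def quat_eq_iff oct_axis_def qc_def qw_def qh_def
      algebra_simps inv_sqrt2_sq)

text \<open>The columns are \<open>(v a, a)\<close> and \<open>(w a, w' v a)\<close> with \<open>a = i - \<sigma> j + \<tau> k\<close>. The first one is fixed by the
reflection with parameter \<open>v\<close> and the second one is its image under the reflection with parameter \<open>w\<close>,
which is orthogonal to \<open>v\<close>. The factor \<open>a\<close> satisfies \<open>a i = z v a\<close>, so that each column \<open>x\<close>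
satisfies \<open>J x = x i\<close> for the matrix \<open>J\<close> with rows \<open>(0, z)\<close> and \<open>(z, 0)\<close>.\<close>

definition ico_basis :: "quat^2^2" where
  "ico_basis = mat2 (Quat (- sigma) 0 1 tau) (Quat (- tau) 1 0 (- sigma))
     (Quat 0 1 (- sigma) tau) (Quat tau sigma 1 0)"

text \<open>The conjugate transpose of \<open>ico_basis\<close>, divided by the squared length \<open>8\<close> of its columns.\<close>

definition ico_basis_inv :: "quat^2^2" where
  "ico_basis_inv = mat2 (Quat (- sigma) 0 (- 1) (- tau) /\<^sub>R 8) (Quat 0 (- 1) sigma (- tau) /\<^sub>R 8)
     (Quat (- tau) (- 1) 0 sigma /\<^sub>R 8) (Quat tau (- sigma) (- 1) 0 /\<^sub>R 8)"

lemma ico_basis_inverse: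
  "ico_basis ** ico_basis_inv = mat 1" "ico_basis_inv ** ico_basis = mat 1"
  by (simp_all add: ico_basis_def ico_basis_inv_def mat_1_mat2 quat_eq_iff qv_def qw_def
      sigma_def algebra_simps tau_sq tau_sq' add_divide_distrib diff_divide_distrib)

definition qp :: quat where "qp = (1 + (tau - 1) *\<^sub>R qi) /\<^sub>R 2"

lemma swap_ico_basis:
  "swap_mat 1 ** ico_basis = ico_basis ** mat2 ((tau / 2) *\<^sub>R 1) qp (qcnj qp) (- ((tau / 2) *\<^sub>R 1))"
  "swap_mat qw ** ico_basis = ico_basis ** mat2 0 1 1 0"
  "swap_mat qv ** ico_basis = ico_basis ** mat2 1 0 0 (- 1)"
  by (simp_all add: ico_basis_def swap_mat_def quat_eq_iff qv_def qw_def qp_def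
      sigma_def algebra_simps tau_sq tau_sq' add_divide_distrib diff_divide_distrib)

lemma quat_matrix_G22:
  "quat_matrix st_p =
    mat2 ((tau / 2) *\<^sub>R 1) qp (qcnj qp) (- ((tau / 2) *\<^sub>R 1))"
  "quat_matrix st_e1 = mat2 0 1 1 0"
  by (simp_all add: quat_matrix_mat2 quat_of_complex_def qp_def quat_eq_iff field_simps)


section \<open>The additional systems of the fifteen groups\<close>

lemma unit_multiples:
  assumes "qdot u u = 1"
  shows "{q \<in> {\<alpha> *\<^sub>R u | \<alpha>. \<alpha> \<noteq> 0}. qdot q q = 1} = {u, - u}"
proof -
  have "qdot (\<alpha> *\<^sub>R u) (\<alpha> *\<^sub>R u) = \<alpha> * \<alpha> * qdot u u" for \<alpha>
    by (simp add: qdot_def algebra_simps)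
  then have *: "qdot (\<alpha> *\<^sub>R u) (\<alpha> *\<^sub>R u) = 1 \<longleftrightarrow> \<alpha> = 1 \<or> \<alpha> = - 1" for \<alpha>
    using assms by (simp add: square_eq_1_iff)
  show ?thesis
  proof (intro equalityI subsetI)
    fix q assume "q \<in> {q \<in> {\<alpha> *\<^sub>R u | \<alpha>. \<alpha> \<noteq> 0}. qdot q q = 1}"
    then show "q \<in> {u, - u}" using * by auto
  next
    have "qdot (- u) (- u) = 1" using *[of "- 1"] by simp
    moreover have "u = 1 *\<^sub>R u \<and> (1::real) \<noteq> 0" "- u = (- 1) *\<^sub>R u \<and> (- 1::real) \<noteq> 0" by simp_all
    moreover fix q assume "q \<in> {u, - u}"
    ultimately show "q \<in> {q \<in> {\<alpha> *\<^sub>R u | \<alpha>. \<alpha> \<noteq> 0}. qdot q q = 1}"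
      using assms by blast
  qed
qed

text \<open>Except for the group with \<open>L = {1, i}\<close>, the parameters are arranged as successive insertions into
\<open>{1, w}\<close>, each of which refines the set of axes.\<close>

lemma groups_eq:
  "GT_L12_1 = QG {qi, 1, qw} {}" "GT_L12_C2 = QG {qi, 1, qw} {- 1}"
  "GT_T_Q8 = QG {qj, qi, 1, qw} {}" "GT_T_T = QG {1, qi} {qw}"
  "GO_O_O = QG {1, qw} {qc}" "GO_O_T = QG {qd, qc, 1, qw} {}"
  "GO_L32_Q8 = QG {qj, qc, 1, qw} {}" "GO_L20_C2 = QG {qu, qc, 1, qw} {}"
  "GO_L18_1 = QG {qc, 1, qw} {}" "GO_L14_1 = QG {qu, qi, 1, qw} {}"
  "GI_I_I = QG {qv, qi, 1, qw} {}" "GI_L32_C2 = QG {qz, qv, 1, qw} {}"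
  "GI_L30_1 = QG {qv, 1, qw} {}" "GI_L20_C2 = QG {qy, qi, 1, qw} {- 1}"
  "GI_L20_1 = QG {qy, qi, 1, qw} {}"
  by (simp_all add: GT_L12_1_def GT_L12_C2_def GT_T_Q8_def GT_T_T_def GO_O_O_def GO_O_T_def
      GO_L32_Q8_def GO_L20_C2_def GO_L18_1_def GO_L14_1_def GI_I_I_def GI_L32_C2_def GI_L30_1_def
      GI_L20_C2_def GI_L20_1_def qc_def qd_def qy_def insert_commute)

lemma additional_systems_axes:
  assumes "\<forall>b\<in>L. qdot b b = 1" "1 \<in> L" "qw \<in> L"
  shows "additional_systems (QG L {}) = system_of ` axes L"
    and "additional_systems (QG L {- 1}) = system_of ` {q \<in> axes L. qdot q q = 1}"
  by (rule additional_systems_no_homology[OF assms qw_not_pure_not_real]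
      additional_systems_minus_one[OF assms qw_not_pure_not_real])+

lemma single_additional_system:
  "additional_systems GT_L12_C2 = {system_of qu}"
  "additional_systems GO_L14_1 = {system_of qu}"
  "additional_systems GO_L20_C2 = {system_of qu}"
  "additional_systems GI_L32_C2 = {system_of qz}"
proof -
  note single_u = system_of_opposite_units[OF pure_consts(1) unit_consts(6) refl]
  note single_z = system_of_opposite_units[OF pure_consts(2) unit_consts(7) refl]
  have "additional_systems GT_L12_C2 = system_of ` {q \<in> axes {qi, 1, qw}. qdot q q = 1}"
    unfolding groups_eq by (rule additional_systems_axes(2)) (simp_all add: unit_consts)
  then show "additional_systems GT_L12_C2 = {system_of qu}"
    unfolding axes_qi unit_multiples[OF unit_consts(6)] single_u .
  have "additional_systems GO_L14_1 = system_of ` axes {qu, qi, 1, qw}"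
    unfolding groups_eq by (rule additional_systems_axes(1)) (simp_all add: unit_consts)
  then show "additional_systems GO_L14_1 = {system_of qu}"
    unfolding axes_insert_axis[OF axes_qi unit_consts(6)] single_u .
  have "additional_systems GO_L20_C2 = system_of ` axes {qu, qc, 1, qw}"
    unfolding groups_eq by (rule additional_systems_axes(1)) (simp_all add: unit_consts)
  then show "additional_systems GO_L20_C2 = {system_of qu}"
    unfolding axes_insert_axis[OF axes_qc unit_consts(6)] single_u .
  have "additional_systems GI_L32_C2 = system_of ` axes {qz, qv, 1, qw}"
    unfolding groups_eq by (rule additional_systems_axes(1)) (simp_all add: unit_consts)
  then show "additional_systems GI_L32_C2 = {system_of qz}"
    unfolding axes_insert_axis[OF axes_qv unit_consts(7)] single_z .
qed

lemma families_of_additional_systems: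
  defines "I \<equiv> {\<alpha>::real. - 1 < \<alpha> \<and> \<alpha> \<le> 1 \<and> \<alpha> \<noteq> 0}"
  shows "bij_betw (\<lambda>\<alpha>. system_of (\<alpha> *\<^sub>R qu)) I (additional_systems GT_L12_1)"
    and "bij_betw (\<lambda>\<alpha>. system_of (\<alpha> *\<^sub>R qu)) I (additional_systems GO_L18_1)"
    and "bij_betw (\<lambda>\<alpha>. system_of (\<alpha> *\<^sub>R qz)) I (additional_systems GI_L30_1)"
proof -
  have "additional_systems GT_L12_1 = system_of ` axes {qi, 1, qw}"
    "additional_systems GO_L18_1 = system_of ` axes {qc, 1, qw}"
    "additional_systems GI_L30_1 = system_of ` axes {qv, 1, qw}"
    unfolding groups_eq by (rule additional_systems_axes(1); simp add: unit_consts)+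
  then show "bij_betw (\<lambda>\<alpha>. system_of (\<alpha> *\<^sub>R qu)) I (additional_systems GT_L12_1)"
    "bij_betw (\<lambda>\<alpha>. system_of (\<alpha> *\<^sub>R qu)) I (additional_systems GO_L18_1)"
    "bij_betw (\<lambda>\<alpha>. system_of (\<alpha> *\<^sub>R qz)) I (additional_systems GI_L30_1)"
    using system_of_multiples_bij pure_consts unit_consts axes_qi axes_qc axes_qv
    unfolding I_def by simp_all
qed

lemma groups_without_additional_systems:
  "additional_systems GT_T_T = {}" "additional_systems GT_T_Q8 = {}"
  "additional_systems GO_O_O = {}" "additional_systems GO_O_T = {}"
  "additional_systems GO_L32_Q8 = {}" "additional_systems GI_I_I = {}"
  "additional_systems GI_L20_C2 = {}" "additional_systems GI_L20_1 = {}"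
proof -
  have "qw * qw \<noteq> 1" "qc * qc \<noteq> 1" by (simp_all add: quat_eq_iff quat_consts)
  then show "additional_systems GT_T_T = {}" "additional_systems GO_O_O = {}"
    using no_additional_systems_if_homology[of "{1, qi}" "{qw}" qw]
      no_additional_systems_if_homology[of "{1, qw}" "{qc}" qc]
    by (simp_all add: groups_eq unit_consts)
  have transverse: "qdot qw qj \<noteq> 0" "qdot 1 qd \<noteq> 0" "qdot 1 qv \<noteq> 0" "qdot qw qy \<noteq> 0"
    "qdot qj qu \<noteq> 0" "qdot qd qu \<noteq> 0" "qdot qv qu \<noteq> 0" "qdot qy qu \<noteq> 0"
    using tau_bounds by (simp_all add: qdot_def quat_consts sigma_def diff_divide_distrib)
  have "axes {qj, qi, 1, qw} = {}" "axes {qd, qc, 1, qw} = {}" "axes {qj, qc, 1, qw} = {}"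
    "axes {qv, qi, 1, qw} = {}" "axes {qy, qi, 1, qw} = {}"
    by (simp_all add: axes_empty[OF axes_qi] axes_empty[OF axes_qc] transverse)
  then show "additional_systems GT_T_Q8 = {}" "additional_systems GO_O_T = {}"
    "additional_systems GO_L32_Q8 = {}" "additional_systems GI_I_I = {}"
    "additional_systems GI_L20_C2 = {}" "additional_systems GI_L20_1 = {}"
    unfolding groups_eq using additional_systems_axes by (simp_all add: unit_consts)
qed


section \<open>Conjugacy with Shephard-Todd groups\<close>

lemma shephard_todd_involutions:
  "st_r1 ** st_r1 = mat 1" "st_r2 ** st_r2 = mat 1" "st_r3 ** st_r3 = mat 1"
  "st_e1 ** st_e1 = mat 1" "st_e3 ** st_e3 = mat 1" "st_p ** st_p = mat 1"
  by (simp_all add: mat_1_mat2 complex_eq_iff field_simps tau_sq tau_sq' power2_eq_square)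

text \<open>The parameters \<open>1\<close>, \<open>i\<close>, \<open>w\<close> have the same inner products as \<open>r\<^sub>1\<close>, \<open>- r\<^sub>2\<close>, \<open>- r\<^sub>3\<close>. The latter belong to \<open>G\<^sub>1\<^sub>2\<close>
because \<open>r\<^sub>1\<close> and \<open>r\<^sub>2\<close> anticommute: \<open>r\<^sub>1 r\<^sub>2 r\<^sub>1 = - r\<^sub>2\<close> and \<open>(r\<^sub>1 r\<^sub>2)\<^sup>2 = - 1\<close>.\<close>

lemma GT_L12_1_conjugate_G12: "GL_conjugate GT_L12_1 (quat_matrix ` G12)"
proof -
  define r1 r2 r3 n2 n3 where "r1 = mat2 qh (- qh) (- qh) (- qh)" and "r2 = mat2 qh qh qh (- qh)"
    and "r3 = mat2 0 qc (qcnj qc) 0" and "n2 = mat2 (- qh) (- qh) (- qh) qh"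
    and "n3 = mat2 0 (- qc) (- qcnj qc) 0"
  note rs = this
  define M where "M b = (if b = 1 then r1 else if b = qi then n2 else n3)" for b
  have distinct: "qi \<noteq> 1" "qw \<noteq> 1" "qw \<noteq> qi" by (simp_all add: quat_eq_iff quat_consts)
  have M_image: "M ` {qi, 1, qw} = {r1, n2, n3}" using distinct by (auto simp: M_def)
  have words: "n2 = r1 ** r2 ** r1" "n3 = r1 ** r2 ** r1 ** r2 ** r3"
    "r2 = r1 ** n2 ** r1" "r3 = r1 ** n2 ** r1 ** n2 ** n3"
    by (simp_all add: rs quat_eq_iff qh_def qc_def algebra_simps inv_sqrt2_sq)
  show ?thesis
    unfolding groups_eq G12_def
  proof (rule GL_conjugate_QG[OF oct_basis_inverse(2,1), where M = M])
    show "\<forall>b\<in>{qi, 1, qw}. qdot b b = 1" by (simp add: unit_consts)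
    show "swap_mat b ** oct_basis = oct_basis ** M b" if "b \<in> {qi, 1, qw}" for b
      using that distinct swap_oct_basis by (auto simp: M_def rs)
    show "B ** B = mat 1" if "B \<in> {st_r1, st_r2, st_r3}" for B
      using that shephard_todd_involutions by blast
    have gens: "quat_matrix ` {st_r1, st_r2, st_r3} = {r1, r2, r3}" (is "quat_matrix ` ?Y = _")
      unfolding image_insert image_empty quat_matrix_G12_G13 rs by simp
    have "r1 \<in> generate GL {r1, r2, r3}" "r2 \<in> generate GL {r1, r2, r3}" "r3 \<in> generate GL {r1, r2, r3}"
      by (simp_all add: generate.incl)
    then show "M ` {qi, 1, qw} \<subseteq> generate GL (quat_matrix ` ?Y)"
      unfolding gens M_image using words(1,2) by (auto intro: generate_GL_mult)
    have "r1 \<in> generate GL {r1, n2, n3}" "n2 \<in> generate GL {r1, n2, n3}" "n3 \<in> generate GL {r1, n2, n3}"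
      by (simp_all add: generate.incl)
    then show "quat_matrix ` ?Y \<subseteq> generate GL (M ` {qi, 1, qw})"
      unfolding gens M_image using words(3,4) by (auto intro: generate_GL_mult)
  qed
qed

text \<open>The same base change sends \<open>c = (1 + i) / \<surd>2\<close> to \<open>- e\<^sub>1\<close>, which is the mirror image \<open>r\<^sub>1 e\<^sub>3 r\<^sub>1\<close> in
\<open>G\<^sub>1\<^sub>3\<close>; and \<open>- r\<^sub>3 = e\<^sub>3 r\<^sub>3 e\<^sub>3\<close> because \<open>e\<^sub>3\<close> and \<open>r\<^sub>3\<close> anticommute.\<close>

lemma GO_L18_1_conjugate_G13: "GL_conjugate GO_L18_1 (quat_matrix ` G13)"
proof -
  define r1 e3 r3 n1 n3 where "r1 = mat2 qh (- qh) (- qh) (- qh)" and "e3 = mat2 1 0 0 (- 1 :: quat)"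
    and "r3 = mat2 0 qc (qcnj qc) 0" and "n1 = mat2 0 (- 1) (- 1) (0 :: quat)"
    and "n3 = mat2 0 (- qc) (- qcnj qc) 0"
  note rs = this
  define M where "M b = (if b = 1 then r1 else if b = qc then n1 else n3)" for b
  have distinct: "qc \<noteq> 1" "qw \<noteq> 1" "qw \<noteq> qc" by (simp_all add: quat_eq_iff quat_consts)
  have M_image: "M ` {qc, 1, qw} = {r1, n1, n3}" using distinct by (auto simp: M_def)
  have words: "n1 = r1 ** e3 ** r1" "n3 = e3 ** r3 ** e3"
    "e3 = r1 ** n1 ** r1" "r3 = (r1 ** n1 ** r1) ** n3 ** (r1 ** n1 ** r1)"
    by (simp_all add: rs quat_eq_iff qh_def qc_def algebra_simps inv_sqrt2_sq)
  show ?thesis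
    unfolding groups_eq G13_def
  proof (rule GL_conjugate_QG[OF oct_basis_inverse(2,1), where M = M])
    show "\<forall>b\<in>{qc, 1, qw}. qdot b b = 1" by (simp add: unit_consts)
    show "swap_mat b ** oct_basis = oct_basis ** M b" if "b \<in> {qc, 1, qw}" for b
      using that distinct swap_oct_basis by (auto simp: M_def rs)
    show "B ** B = mat 1" if "B \<in> {st_e3, st_r1, st_r3}" for B
      using that shephard_todd_involutions by blast
    have gens: "quat_matrix ` {st_e3, st_r1, st_r3} = {e3, r1, r3}" (is "quat_matrix ` ?Y = _")
      unfolding image_insert image_empty quat_matrix_G12_G13 rs by simp
    have "r1 \<in> generate GL {e3, r1, r3}" "e3 \<in> generate GL {e3, r1, r3}" "r3 \<in> generate GL {e3, r1, r3}"
      by (simp_all add: generate.incl)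
    then show "M ` {qc, 1, qw} \<subseteq> generate GL (quat_matrix ` ?Y)"
      unfolding gens M_image using words(1,2) by (auto intro: generate_GL_mult)
    have "r1 \<in> generate GL {r1, n1, n3}" "n1 \<in> generate GL {r1, n1, n3}" "n3 \<in> generate GL {r1, n1, n3}"
      by (simp_all add: generate.incl)
    then show "quat_matrix ` ?Y \<subseteq> generate GL (M ` {qc, 1, qw})"
      unfolding gens M_image using words(3,4) by (auto intro: generate_GL_mult)
  qed
qed

text \<open>The parameters \<open>1\<close>, \<open>w\<close>, \<open>v\<close> have the same inner products as the three generators \<open>p\<close>, \<open>e\<^sub>1\<close>, \<open>e\<^sub>3\<close> of \<open>G\<^sub>2\<^sub>2\<close>,
which are therefore attained exactly.\<close>

lemma GI_L30_1_conjugate_G22: "GL_conjugate GI_L30_1 (quat_matrix ` G22)"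
proof -
  define e1 e3 p where "e1 = mat2 0 1 1 (0 :: quat)" and "e3 = mat2 1 0 0 (- 1 :: quat)"
    and "p = mat2 ((tau / 2) *\<^sub>R 1) qp (qcnj qp) (- ((tau / 2) *\<^sub>R 1))"
  note rs = this
  define M where "M b = (if b = 1 then p else if b = qw then e1 else e3)" for b
  have distinct: "qv \<noteq> 1" "qw \<noteq> 1" "qw \<noteq> qv" by (simp_all add: quat_eq_iff quat_consts)
  have M_image: "M ` {qv, 1, qw} = {p, e1, e3}" using distinct by (auto simp: M_def)
  show ?thesis
    unfolding groups_eq G22_def
  proof (rule GL_conjugate_QG[OF ico_basis_inverse(2,1), where M = M])
    show "\<forall>b\<in>{qv, 1, qw}. qdot b b = 1" by (simp add: unit_consts)
    show "swap_mat b ** ico_basis = ico_basis ** M b" if "b \<in> {qv, 1, qw}" for b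
      using that distinct swap_ico_basis by (auto simp: M_def rs)
    show "B ** B = mat 1" if "B \<in> {st_e3, st_e1, st_p}" for B
      using that shephard_todd_involutions by blast
    have gens: "quat_matrix ` {st_e3, st_e1, st_p} = M ` {qv, 1, qw}"
      (is "quat_matrix ` ?Y = _")
      unfolding image_insert[of quat_matrix] image_empty quat_matrix_G12_G13 quat_matrix_G22 M_image rs by auto
    show "M ` {qv, 1, qw} \<subseteq> generate GL (quat_matrix ` ?Y)"
      "quat_matrix ` ?Y \<subseteq> generate GL (M ` {qv, 1, qw})"
      unfolding gens by (auto intro: generate.incl)
  qed
qed

theorem theorem5p2:
  shows
   "(\<forall>G \<in> {GT_L12_C2, GO_L14_1, GO_L20_C2}.
       additional_systems G = {system_of ((qj - qk) /\<^sub>R sqrt 2)}) \<and>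
    additional_systems GI_L32_C2 =
       {system_of ((qj - tau *\<^sub>R qi - sigma *\<^sub>R qk) /\<^sub>R 2)} \<and>
    (\<forall>G \<in> {GT_L12_1, GO_L18_1}.
       bij_betw (\<lambda>\<alpha>. system_of (\<alpha> *\<^sub>R ((qj - qk) /\<^sub>R sqrt 2)))
         {\<alpha>::real. - 1 < \<alpha> \<and> \<alpha> \<le> 1 \<and> \<alpha> \<noteq> 0} (additional_systems G)) \<and>
    bij_betw (\<lambda>\<alpha>. system_of (\<alpha> *\<^sub>R ((qj - tau *\<^sub>R qi - sigma *\<^sub>R qk) /\<^sub>R 2)))
       {\<alpha>::real. - 1 < \<alpha> \<and> \<alpha> \<le> 1 \<and> \<alpha> \<noteq> 0} (additional_systems GI_L30_1) \<and>
    (\<forall>G \<in> {GT_T_T, GT_T_Q8, GO_O_O, GO_O_T, GO_L32_Q8, GI_I_I, GI_L20_C2, GI_L20_1}.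
       additional_systems G = {}) \<and>
    GL_conjugate GT_L12_1 (quat_matrix ` G12) \<and>
    GL_conjugate GO_L18_1 (quat_matrix ` G13) \<and>
    GL_conjugate GI_L30_1 (quat_matrix ` G22)"
  unfolding qu_def[symmetric] qz_def[symmetric]
  using single_additional_system families_of_additional_systems groups_without_additional_systems GT_L12_1_conjugate_G12 GO_L18_1_conjugate_G13
    GI_L30_1_conjugate_G22
  by (auto simp only: ball_simps insert_iff empty_iff)

end
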